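(* Let $\mathcal H$ be an infinite dimensional separable Hilbert space with a fixed orthonormal basis $\{e_n:n\in\mathbb N\}$, and equip $S_2(\mathcal H)$ with the Schur product with respect to this basis. Then the Banach algebra $S_2(\mathcal H)\otimes^\gamma S_2(\mathcal H)$ (the projective tensor product) is Arens regular.
   Context: Hilbert spaces are complex. $S_2(\mathcal H)$ is the space of Hilbert-Schmidt operators on $\mathcal H$. For $T\in S_2(\mathcal H)$ put $T_{rs}=\langle T(e_s),e_r\rangle$ for $r,s\in\mathbb N$, so that $\|T\|_2^2=\sum_{r,s}|T_{rs}|^2$. The Schur (Hadamard) product $T\star S$ of $T,S\in S_2(\mathcal H)$ is the operator in $S_2(\mathcal H)$ with matrix entries $(T\star S)_{rs}=T_{rs}S_{rs}$; with it, $(S_2(\mathcal H),\|\cdot\|_2)$ is a commutative Banach algebra. Projective tensor product: for Banach algebras $A,B$, the algebraic tensor product $A\otimes B$ has multiplication determined by $(x_1\otimes y_1)(x_2\otimes y_2)=x_1x_2\otimes y_1y_2$ (here both products are Schur products) and norm $\|u\|_\gamma=\inf\{\sum_{i=1}^n\|x_i\|\|y_i\| : u=\sum_{i=1}^n x_i\otimes y_i\}$; its completion is the Banach algebra $A\otimes^\gamma B$. Arens regularity: let $A$ be a normed algebra. For $a\in A$, $\omega\in A^*$, $f\in A^{**}$ define $\omega_a,{}_a\omega\in A^*$ by $\omega_a(b)=\omega(ab)$, ${}_a\omega(b)=\omega(ba)$, and $\omega_f,{}_f\omega\in A^*$ by $\omega_f(a)=f({}_a\omega)$, ${}_f\omega(a)=f(\omega_a)$.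 For $f,g\in A^{**}$ set $(f\Box g)(\omega)=f({}_g\omega)$ and $(f\diamond g)(\omega)=g(\omega_f)$ for $\omega\in A^*$. $A$ is Arens regular if $f\Box g=f\diamond g$ for all $f,g\in A^{**}$. *)

theory Defs
  imports "HOL-Analysis.Analysis"
begin

section \<open>Complex Hilbert spaces\<close>

text \<open>The complex inner product is linear in its first argument; the norm and the topology are
  those of the underlying real Hilbert space, whose inner product is the real part.\<close>

class chilbert_space = real_inner + complete_space +
  fixes scaleC :: "complex \<Rightarrow> 'a \<Rightarrow> 'a" (infixr "*\<^sub>C" 75)
    and cinner :: "'a \<Rightarrow> 'a \<Rightarrow> complex"
  assumes scaleC_add_right: "c *\<^sub>C (x + y) = c *\<^sub>C x + c *\<^sub>C y"
    and scaleC_add_left: "(c + d) *\<^sub>C x = c *\<^sub>C x + d *\<^sub>C x"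
    and scaleC_scaleC: "c *\<^sub>C (d *\<^sub>C x) = (c * d) *\<^sub>C x"
    and scaleC_of_real: "complex_of_real r *\<^sub>C x = r *\<^sub>R x"
    and cinner_commute: "cinner x y = cnj (cinner y x)"
    and cinner_add_left: "cinner (x + y) z = cinner x z + cinner y z"
    and cinner_scaleC_left: "cinner (c *\<^sub>C x) y = c * cinner x y"
    and Re_cinner: "Re (cinner x y) = inner x y"

definition orthonormal_basis :: "(nat \<Rightarrow> 'h::chilbert_space) \<Rightarrow> bool" where
  "orthonormal_basis e \<longleftrightarrow>
     (\<forall>m n. cinner (e m) (e n) = (if m = n then 1 else 0)) \<and>
     closure (module.span scaleC (range e)) = UNIV"

section \<open>Normed spaces and normed algebras\<close>

text \<open>Complex normed spaces and algebras are given by a carrier set and operations; only the values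
  of the operations on the carrier matter.\<close>

record 'a cspace =
  vcarrier :: "'a set"
  vzero :: 'a
  vadd :: "'a \<Rightarrow> 'a \<Rightarrow> 'a"
  vscale :: "complex \<Rightarrow> 'a \<Rightarrow> 'a"
  vnorm :: "'a \<Rightarrow> real"

record 'a calgebra = "'a cspace" +
  vmult :: "'a \<Rightarrow> 'a \<Rightarrow> 'a"

definition vdiff :: "('a, 'm) cspace_scheme \<Rightarrow> 'a \<Rightarrow> 'a \<Rightarrow> 'a" where
  "vdiff A x y = vadd A x (vscale A (-1) y)"

definition linear_form :: "('a, 'm) cspace_scheme \<Rightarrow> ('a \<Rightarrow> complex) \<Rightarrow> bool" where
  "linear_form A \<phi> \<longleftrightarrow>
     (\<forall>x\<in>vcarrier A. \<forall>y\<in>vcarrier A. \<phi> (vadd A x y) = \<phi> x + \<phi> y) \<and>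
     (\<forall>c. \<forall>x\<in>vcarrier A. \<phi> (vscale A c x) = c * \<phi> x)"

section \<open>Hilbert-Schmidt operators with the Schur product\<close>

definition matrix_entry ::
    "(nat \<Rightarrow> 'h::chilbert_space) \<Rightarrow> ('h \<Rightarrow> 'h) \<Rightarrow> nat \<Rightarrow> nat \<Rightarrow> complex" where
  "matrix_entry e T r s = cinner (T (e s)) (e r)"

definition hilbert_schmidt :: "(nat \<Rightarrow> 'h::chilbert_space) \<Rightarrow> ('h \<Rightarrow> 'h) set" where
  "hilbert_schmidt e =
     {T. bounded_linear T \<and> (\<forall>c x. T (c *\<^sub>C x) = c *\<^sub>C T x) \<and>
         summable (\<lambda>s. (norm (T (e s)))\<^sup>2)}"

definition hs_norm :: "(nat \<Rightarrow> 'h::chilbert_space) \<Rightarrow> ('h \<Rightarrow> 'h) \<Rightarrow> real" where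
  "hs_norm e T = sqrt (\<Sum>\<^sub>\<infinity>(r, s)\<in>UNIV. (cmod (matrix_entry e T r s))\<^sup>2)"

definition schur_product ::
    "(nat \<Rightarrow> 'h::chilbert_space) \<Rightarrow> ('h \<Rightarrow> 'h) \<Rightarrow> ('h \<Rightarrow> 'h) \<Rightarrow> ('h \<Rightarrow> 'h)" where
  "schur_product e T S =
     (THE R. R \<in> hilbert_schmidt e \<and>
        (\<forall>r s. matrix_entry e R r s = matrix_entry e T r s * matrix_entry e S r s))"

definition S2 :: "(nat \<Rightarrow> 'h::chilbert_space) \<Rightarrow> ('h \<Rightarrow> 'h) calgebra" where
  "S2 e =
     \<lparr>vcarrier = hilbert_schmidt e,
      vzero = (\<lambda>_. 0),
      vadd = (\<lambda>T S x. T x + S x),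
      vscale = (\<lambda>c T x. c *\<^sub>C T x),
      vnorm = hs_norm e,
      vmult = schur_product e\<rparr>"

section \<open>The projective tensor product\<close>

text \<open>The algebraic tensor product is realised in the dual of the space of all (not necessarily
  bounded) bilinear forms: the elementary tensor of \<open>x\<close> and \<open>y\<close> is evaluation at \<open>(x, y)\<close>.
  Functionals on a space of forms are extended by 0 outside that space, so that equality of
  functions is equality of tensors.\<close>

definition bilinear_forms ::
    "('a, 'm) cspace_scheme \<Rightarrow> ('b, 'n) cspace_scheme \<Rightarrow> ('a \<Rightarrow> 'b \<Rightarrow> complex) set" where
  "bilinear_forms A B =
     {\<beta>. (\<forall>x\<in>vcarrier A. linear_form B (\<beta> x)) \<and>
         (\<forall>y\<in>vcarrier B. linear_form A (\<lambda>x. \<beta> x y))}"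

definition elementary_tensor ::
    "('a, 'm) cspace_scheme \<Rightarrow> ('b, 'n) cspace_scheme \<Rightarrow> 'a \<Rightarrow> 'b \<Rightarrow>
     (('a \<Rightarrow> 'b \<Rightarrow> complex) \<Rightarrow> complex)" where
  "elementary_tensor A B x y = (\<lambda>\<beta>. if \<beta> \<in> bilinear_forms A B then \<beta> x y else 0)"

definition tensor_representation ::
    "('a, 'm) cspace_scheme \<Rightarrow> ('b, 'n) cspace_scheme \<Rightarrow> (('a \<Rightarrow> 'b \<Rightarrow> complex) \<Rightarrow> complex) \<Rightarrow>
     nat \<Rightarrow> (nat \<Rightarrow> 'a) \<Rightarrow> (nat \<Rightarrow> 'b) \<Rightarrow> bool" where
  "tensor_representation A B u n x y \<longleftrightarrow>
     (\<forall>i<n. x i \<in> vcarrier A \<and> y i \<in> vcarrier B) \<and>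
     u = (\<lambda>\<beta>. \<Sum>i<n. elementary_tensor A B (x i) (y i) \<beta>)"

definition projective_norm ::
    "('a, 'm) cspace_scheme \<Rightarrow> ('b, 'n) cspace_scheme \<Rightarrow>
     (('a \<Rightarrow> 'b \<Rightarrow> complex) \<Rightarrow> complex) \<Rightarrow> real" where
  "projective_norm A B u =
     Inf {(\<Sum>i<n. vnorm A (x i) * vnorm B (y i)) | n x y. tensor_representation A B u n x y}"

definition tensor_mult ::
    "('a, 'm) calgebra_scheme \<Rightarrow> ('b, 'n) calgebra_scheme \<Rightarrow>
     (('a \<Rightarrow> 'b \<Rightarrow> complex) \<Rightarrow> complex) \<Rightarrow> (('a \<Rightarrow> 'b \<Rightarrow> complex) \<Rightarrow> complex) \<Rightarrow>
     (('a \<Rightarrow> 'b \<Rightarrow> complex) \<Rightarrow> complex)" where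
  "tensor_mult A B u v =
     (\<lambda>\<beta>. if \<beta> \<in> bilinear_forms A B
          then u (\<lambda>x\<^sub>1 y\<^sub>1. v (\<lambda>x\<^sub>2 y\<^sub>2. \<beta> (vmult A x\<^sub>1 x\<^sub>2) (vmult B y\<^sub>1 y\<^sub>2)))
          else 0)"

definition algebraic_tensor ::
    "('a, 'm) calgebra_scheme \<Rightarrow> ('b, 'n) calgebra_scheme \<Rightarrow>
     (('a \<Rightarrow> 'b \<Rightarrow> complex) \<Rightarrow> complex) calgebra" where
  "algebraic_tensor A B =
     \<lparr>vcarrier = {u. \<exists>n x y. tensor_representation A B u n x y},
      vzero = (\<lambda>_. 0),
      vadd = (\<lambda>u v \<beta>. u \<beta> + v \<beta>),
      vscale = (\<lambda>c u \<beta>. c * u \<beta>),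
      vnorm = projective_norm A B,
      vmult = tensor_mult A B\<rparr>"

text \<open>If the carriers are closed under the operations and the multiplications are bilinear, then
  \<^const>\<open>tensor_mult\<close> is the multiplication determined by
  $(x_1 \otimes y_1)(x_2 \otimes y_2) = x_1 x_2 \otimes y_1 y_2$.\<close>

definition bilinear_mult :: "('a, 'm) calgebra_scheme \<Rightarrow> bool" where
  "bilinear_mult A \<longleftrightarrow>
     (\<forall>a\<in>vcarrier A. \<forall>b\<in>vcarrier A.
        vadd A a b \<in> vcarrier A \<and> vmult A a b \<in> vcarrier A \<and>
        (\<forall>c\<in>vcarrier A.
           vmult A (vadd A a b) c = vadd A (vmult A a c) (vmult A b c) \<and>
           vmult A c (vadd A a b) = vadd A (vmult A c a) (vmult A c b)) \<and>
        (\<forall>k. vscale A k a \<in> vcarrier A \<and>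
             vmult A (vscale A k a) b = vscale A k (vmult A a b) \<and>
             vmult A a (vscale A k b) = vscale A k (vmult A a b)))"

lemma tensor_mult_representation:
  assumes A: "bilinear_mult A" and B: "bilinear_mult B"
    and u: "tensor_representation A B u m x y"
    and v: "tensor_representation A B v n z w"
  shows "tensor_mult A B u v =
    (\<lambda>\<beta>. \<Sum>i<m. \<Sum>j<n. elementary_tensor A B (vmult A (x i) (z j)) (vmult B (y i) (w j)) \<beta>)"
proof
  fix \<beta>
  show "tensor_mult A B u v \<beta> =
    (\<Sum>i<m. \<Sum>j<n. elementary_tensor A B (vmult A (x i) (z j)) (vmult B (y i) (w j)) \<beta>)"
  proof (cases "\<beta> \<in> bilinear_forms A B")
    case False
    then show ?thesis by (simp add: tensor_mult_def elementary_tensor_def)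
  next
    case \<beta>: True
    let ?F = "\<lambda>a b. v (\<lambda>c d. \<beta> (vmult A a c) (vmult B b d))"
    have lin: "\<beta> (vadd A a a') b = \<beta> a b + \<beta> a' b" "\<beta> (vscale A k a) b = k * \<beta> a b"
      "\<beta> a (vadd B b b') = \<beta> a b + \<beta> a b'" "\<beta> a (vscale B k b) = k * \<beta> a b"
      if "a \<in> vcarrier A" "a' \<in> vcarrier A" "b \<in> vcarrier B" "b' \<in> vcarrier B" for a a' b b' k
      using \<beta> that by (auto simp: bilinear_forms_def linear_form_def)
    have xy: "x i \<in> vcarrier A" "y i \<in> vcarrier B" if "i < m" for i
      using u that by (auto simp: tensor_representation_def)
    have zw: "z j \<in> vcarrier A" "w j \<in> vcarrier B" if "j < n" for j
      using v that by (auto simp: tensor_representation_def)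
    note mult = A[unfolded bilinear_mult_def, rule_format] B[unfolded bilinear_mult_def, rule_format]
    have F: "?F a b = (\<Sum>j<n. \<beta> (vmult A a (z j)) (vmult B b (w j)))"
      if "a \<in> vcarrier A" "b \<in> vcarrier B" for a b
    proof -
      have "(\<lambda>c d. \<beta> (vmult A a c) (vmult B b d)) \<in> bilinear_forms A B"
        using that by (simp add: bilinear_forms_def linear_form_def mult lin)
      then show ?thesis using v by (simp add: tensor_representation_def elementary_tensor_def)
    qed
    have "?F \<in> bilinear_forms A B"
      by (simp add: bilinear_forms_def linear_form_def F mult lin zw sum.distrib sum_distrib_left)
    then have "u ?F = (\<Sum>i<m. ?F (x i) (y i))"
      using u by (simp add: tensor_representation_def elementary_tensor_def)
    with \<beta> show ?thesis
      by (simp add: tensor_mult_def elementary_tensor_def F xy)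
  qed
qed

section \<open>Completion\<close>

text \<open>The completion consists of the Cauchy sequences modulo null sequences; the operations are
  induced by the pointwise ones, and the norm is the limit of the norms along any
  representative.\<close>

definition cauchy_seqs :: "('a, 'm) cspace_scheme \<Rightarrow> (nat \<Rightarrow> 'a) set" where
  "cauchy_seqs A =
     {s. (\<forall>n. s n \<in> vcarrier A) \<and>
         (\<forall>\<epsilon>>0. \<exists>N. \<forall>m\<ge>N. \<forall>n\<ge>N. vnorm A (vdiff A (s m) (s n)) < \<epsilon>)}"

definition null_rel :: "('a, 'm) cspace_scheme \<Rightarrow> ((nat \<Rightarrow> 'a) \<times> (nat \<Rightarrow> 'a)) set" where
  "null_rel A =
     {(s, t). s \<in> cauchy_seqs A \<and> t \<in> cauchy_seqs A \<and>
        (\<lambda>n. vnorm A (vdiff A (s n) (t n))) \<longlonglongrightarrow> 0}"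

definition completion :: "('a, 'm) calgebra_scheme \<Rightarrow> (nat \<Rightarrow> 'a) set calgebra" where
  "completion A =
     \<lparr>vcarrier = cauchy_seqs A // null_rel A,
      vzero = null_rel A `` {\<lambda>_. vzero A},
      vadd = (\<lambda>X Y. \<Union>s\<in>X. \<Union>t\<in>Y. null_rel A `` {\<lambda>n. vadd A (s n) (t n)}),
      vscale = (\<lambda>c X. \<Union>s\<in>X. null_rel A `` {\<lambda>n. vscale A c (s n)}),
      vnorm = (\<lambda>X. the_elem ((\<lambda>s. lim (\<lambda>n. vnorm A (s n))) ` X)),
      vmult = (\<lambda>X Y. \<Union>s\<in>X. \<Union>t\<in>Y. null_rel A `` {\<lambda>n. vmult A (s n) (t n)})\<rparr>"

definition projective_tensor ::
    "('a, 'm) calgebra_scheme \<Rightarrow> ('b, 'n) calgebra_scheme \<Rightarrow>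
     (nat \<Rightarrow> ('a \<Rightarrow> 'b \<Rightarrow> complex) \<Rightarrow> complex) set calgebra" where
  "projective_tensor A B = completion (algebraic_tensor A B)"

section \<open>Arens regularity\<close>

text \<open>Functionals are extended by 0 outside the carrier, so that equality of functions is equality
  of functionals.\<close>

definition dual :: "('a, 'm) cspace_scheme \<Rightarrow> ('a \<Rightarrow> complex) cspace" where
  "dual A =
     \<lparr>vcarrier = {\<omega>. linear_form A \<omega> \<and>
                    (\<exists>K. \<forall>a\<in>vcarrier A. cmod (\<omega> a) \<le> K * vnorm A a) \<and>
                    (\<forall>a. a \<notin> vcarrier A \<longrightarrow> \<omega> a = 0)},
      vzero = (\<lambda>_. 0),
      vadd = (\<lambda>\<omega> \<eta> a. \<omega> a + \<eta> a),
      vscale = (\<lambda>c \<omega> a. c * \<omega> a),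
      vnorm = (\<lambda>\<omega>. Sup {cmod (\<omega> a) | a. a \<in> vcarrier A \<and> vnorm A a \<le> 1})\<rparr>"

abbreviation bidual :: "('a, 'm) cspace_scheme \<Rightarrow> (('a \<Rightarrow> complex) \<Rightarrow> complex) cspace" where
  "bidual A \<equiv> dual (dual A)"

text \<open>In the notation of Arens, \<open>mult_left A \<omega> a\<close> is $\omega_a$ and \<open>mult_right A a \<omega>\<close> is
  ${}_a\omega$; likewise for functionals \<open>f\<close> on the dual in place of \<open>a\<close>.\<close>

definition mult_left :: "('a, 'm) calgebra_scheme \<Rightarrow> ('a \<Rightarrow> complex) \<Rightarrow> 'a \<Rightarrow> ('a \<Rightarrow> complex)" where
  "mult_left A \<omega> a = (\<lambda>b. if b \<in> vcarrier A then \<omega> (vmult A a b) else 0)"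

definition mult_right :: "('a, 'm) calgebra_scheme \<Rightarrow> 'a \<Rightarrow> ('a \<Rightarrow> complex) \<Rightarrow> ('a \<Rightarrow> complex)" where
  "mult_right A a \<omega> = (\<lambda>b. if b \<in> vcarrier A then \<omega> (vmult A b a) else 0)"

definition bidual_left ::
    "('a, 'm) calgebra_scheme \<Rightarrow> ('a \<Rightarrow> complex) \<Rightarrow> (('a \<Rightarrow> complex) \<Rightarrow> complex) \<Rightarrow>
     ('a \<Rightarrow> complex)" where
  "bidual_left A \<omega> f = (\<lambda>a. if a \<in> vcarrier A then f (mult_right A a \<omega>) else 0)"

definition bidual_right ::
    "('a, 'm) calgebra_scheme \<Rightarrow> (('a \<Rightarrow> complex) \<Rightarrow> complex) \<Rightarrow> ('a \<Rightarrow> complex) \<Rightarrow>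
     ('a \<Rightarrow> complex)" where
  "bidual_right A f \<omega> = (\<lambda>a. if a \<in> vcarrier A then f (mult_left A \<omega> a) else 0)"

definition arens_box ::
    "('a, 'm) calgebra_scheme \<Rightarrow> (('a \<Rightarrow> complex) \<Rightarrow> complex) \<Rightarrow> (('a \<Rightarrow> complex) \<Rightarrow> complex) \<Rightarrow>
     (('a \<Rightarrow> complex) \<Rightarrow> complex)" where
  "arens_box A f g =
     (\<lambda>\<omega>. if \<omega> \<in> vcarrier (dual A) then f (bidual_right A g \<omega>) else 0)"

definition arens_diamond ::
    "('a, 'm) calgebra_scheme \<Rightarrow> (('a \<Rightarrow> complex) \<Rightarrow> complex) \<Rightarrow> (('a \<Rightarrow> complex) \<Rightarrow> complex) \<Rightarrow>
     (('a \<Rightarrow> complex) \<Rightarrow> complex)" where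
  "arens_diamond A f g =
     (\<lambda>\<omega>. if \<omega> \<in> vcarrier (dual A) then g (bidual_left A \<omega> f) else 0)"

definition arens_regular :: "('a, 'm) calgebra_scheme \<Rightarrow> bool" where
  "arens_regular A \<longleftrightarrow>
     (\<forall>f\<in>vcarrier (bidual A). \<forall>g\<in>vcarrier (bidual A). arens_box A f g = arens_diamond A f g)"

end

theory Submission
  imports Defs
begin

text \<open>The Schur product turns \<open>S\<^sub>2(H)\<close> into $\ell^2$ of the matrix positions with pointwise
  multiplication. Expanding in matrix units, every bounded functional $\omega$ on the projective
  tensor product satisfies $\omega(ab) = \sum_k \omega(E_k) a_k b_k$, where $E_k$ are the tensors of
  matrix units; the coordinates $(a_k)$ are square summable with $\ell^2$-norm at most
  $\|a\|_\gamma$, and $|\omega(E_k)| \le \|\omega\|$. Hence $(a, b) \mapsto \omega(ab)$ factors through a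
  Hilbert space: by the Riesz representation theorem the functionals $f, g$ in the bidual act on
  coordinate functionals through square-summable families $(f_k), (g_k)$, and both Arens products
  evaluate at $\omega$ to $\sum_k \omega(E_k) f_k g_k$.\<close>

section \<open>Square-summable families\<close>

text \<open>The values \<open>\<omega> (E k)\<close> are in general only bounded: the bilinear form
  that sums the products of corresponding matrix entries is bounded by Cauchy-Schwarz and takes the
  value 1 at infinitely many tensors of matrix units. Hence the coordinate bound gives no absolutely
  convergent expansion of \<open>\<omega> a\<close> for a single element, whereas the coordinates of
  a product of two elements form an l1 family, which pairs with bounded weights. For this reason the
  property carried through the constructions is the expansion of \<open>\<omega>\<close> on products
  only. The locale \<open>coordinates\<close> isolates it; the algebraic tensor product inherits it
  through a sum over pairs of indices, the completion through continuity. \<open>l2_le x M\<close>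
  says that the l2 norm of \<open>x\<close> is at most \<open>M\<close>. Phrased by finite partial
  norms, it makes summability a consequence and lets estimates be checked on finite sets.\<close>

definition l2_le :: "('k \<Rightarrow> complex) \<Rightarrow> real \<Rightarrow> bool" where
  "l2_le x M \<longleftrightarrow> (\<forall>F. finite F \<longrightarrow> L2_set (\<lambda>k. cmod (x k)) F \<le> M)"

definition unit_seq :: "'k \<Rightarrow> 'k \<Rightarrow> complex" where
  "unit_seq k j = (if j = k then 1 else 0)"

lemma l2_leI: "(\<And>F. finite F \<Longrightarrow> L2_set (\<lambda>k. cmod (x k)) F \<le> M) \<Longrightarrow> l2_le x M"
  by (simp add: l2_le_def)

lemma l2_leD: "l2_le x M \<Longrightarrow> L2_set (\<lambda>k. cmod (x k)) F \<le> M"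
  \<comment> \<open>For infinite \<open>F\<close> the sum inside \<open>L2_set\<close> is 0 by
    default, and the empty set supplies 0 \<le> \<open>M\<close>.\<close>
  by (cases "finite F") (auto simp: l2_le_def dest: spec[of _ "{}"])

lemma l2_le_nonneg: "l2_le x M \<Longrightarrow> 0 \<le> M"
  using l2_leD[of x M "{}"] by simp

lemma l2_le_cmod: "l2_le x M \<Longrightarrow> cmod (x k) \<le> M"
  using l2_leD[of x M "{k}"] by simp

lemma l2_le_sum_squares:
  assumes "l2_le x M"
  shows "(\<Sum>k\<in>F. (cmod (x k))\<^sup>2) \<le> M\<^sup>2"
  using l2_leD[OF assms, of F] by (simp add: L2_set_def sqrt_le_D)

lemma l2_le_squares_summable:
  assumes "l2_le x M"
  shows "(\<lambda>k. (cmod (x k))\<^sup>2) summable_on UNIV"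
  by (intro nonneg_bdd_above_summable_on bdd_aboveI2[where M = "M\<^sup>2"])
    (auto intro: l2_le_sum_squares[OF assms])

lemma l2_le_inj:
  assumes "l2_le x M" "inj f"
  shows "l2_le (\<lambda>k. x (f k)) M"
proof (rule l2_leI)
  fix F
  have "L2_set (\<lambda>k. cmod (x (f k))) F = L2_set (\<lambda>k. cmod (x k)) (f ` F)"
    using inj_on_subset[OF assms(2)] by (simp add: L2_set_def sum.reindex)
  with l2_leD[OF assms(1)] show "L2_set (\<lambda>k. cmod (x (f k))) F \<le> M"
    by simp
qed

lemma l2_le_add:
  assumes "l2_le x M" "l2_le y N"
  shows "l2_le (\<lambda>k. x k + y k) (M + N)"
proof (rule l2_leI)
  fix F
  have "L2_set (\<lambda>k. cmod (x k + y k)) F \<le> L2_set (\<lambda>k. cmod (x k) + cmod (y k)) F"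
    by (intro L2_set_mono) (auto simp: norm_triangle_ineq)
  also have "\<dots> \<le> L2_set (\<lambda>k. cmod (x k)) F + L2_set (\<lambda>k. cmod (y k)) F"
    by (rule L2_set_triangle_ineq)
  also have "\<dots> \<le> M + N"
    using assms by (intro add_mono l2_leD)
  finally show "L2_set (\<lambda>k. cmod (x k + y k)) F \<le> M + N" .
qed

text \<open>With \<open>w k = \<omega> (E k)\<close> this is the diagonal operator on l2 through
  which the form sending a, b to \<open>\<omega>\<close> of their product factors.\<close>

lemma l2_le_bounded_mult:
  assumes "l2_le x M" "\<And>k. cmod (w k) \<le> C"
  shows "l2_le (\<lambda>k. w k * x k) (C * M)"
proof (rule l2_leI)
  fix F
  have C: "0 \<le> C"
    using assms(2) norm_ge_zero order_trans by blast
  have "L2_set (\<lambda>k. cmod (w k * x k)) F \<le> L2_set (\<lambda>k. C * cmod (x k)) F"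
    by (intro L2_set_mono) (auto simp: norm_mult assms mult_right_mono)
  also have "\<dots> = C * L2_set (\<lambda>k. cmod (x k)) F"
    using C by (simp add: L2_set_right_distrib)
  also have "\<dots> \<le> C * M"
    using C assms(1) by (intro mult_left_mono l2_leD)
  finally show "L2_set (\<lambda>k. cmod (w k * x k)) F \<le> C * M" .
qed

lemma l2_le_scale: "l2_le x M \<Longrightarrow> l2_le (\<lambda>k. c * x k) (cmod c * M)"
  by (rule l2_le_bounded_mult) auto

text \<open>The constant is the exact norm of the truncation; the duality estimate in
  \<open>l2_le_coefficients\<close> depends on it.\<close>

lemma l2_le_restrict:
  assumes "finite F"
  shows "l2_le (\<lambda>k. if k \<in> F then x k else 0) (L2_set (\<lambda>k. cmod (x k)) F)"
proof (rule l2_leI)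
  fix G :: "'a set" assume G: "finite G"
  have "(\<Sum>k\<in>G. (cmod (if k \<in> F then x k else 0))\<^sup>2) = (\<Sum>k\<in>G \<inter> F. (cmod (x k))\<^sup>2)"
    using G by (intro sum.mono_neutral_cong_right) auto
  also have "\<dots> \<le> (\<Sum>k\<in>F. (cmod (x k))\<^sup>2)"
    using assms by (intro sum_mono2) auto
  finally show "L2_set (\<lambda>k. cmod (if k \<in> F then x k else 0)) G \<le> L2_set (\<lambda>k. cmod (x k)) F"
    by (simp add: L2_set_def)
qed

lemma l2_le_unit_seq: "l2_le (unit_seq k) 1"
proof -
  have "unit_seq k = (\<lambda>j. if j \<in> {k} then 1 else 0)"
    by (auto simp: unit_seq_def)
  with l2_le_restrict[of "{k}" "\<lambda>_. 1"] show ?thesis by simp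
qed

lemma l2_le_mult_sum:
  assumes "l2_le x M" "l2_le y N"
  shows "(\<Sum>k\<in>F. cmod (x k * y k)) \<le> M * N"
proof -
  have "(\<Sum>k\<in>F. cmod (x k * y k)) \<le> L2_set (\<lambda>k. cmod (x k)) F * L2_set (\<lambda>k. cmod (y k)) F"
    using L2_set_mult_ineq[of "\<lambda>k. cmod (x k)" "\<lambda>k. cmod (y k)" F] by (simp add: norm_mult)
  also have "\<dots> \<le> M * N"
    using assms by (intro mult_mono l2_leD) (auto intro: l2_le_nonneg)
  finally show ?thesis .
qed

lemma l2_le_mult_abs_summable:
  assumes "l2_le x M" "l2_le y N"
  shows "(\<lambda>k. norm (x k * y k)) summable_on UNIV"
  by (intro nonneg_bdd_above_summable_on bdd_aboveI2[where M = "M * N"])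
    (auto intro: l2_le_mult_sum[OF assms])

lemma l2_le_mult_summable:
  assumes "l2_le x M" "l2_le y N"
  shows "(\<lambda>k. x k * y k) summable_on UNIV"
  using l2_le_mult_abs_summable[OF assms] by (rule abs_summable_summable)

lemma l2_le_mult_infsum:
  assumes "l2_le x M" "l2_le y N"
  shows "cmod (\<Sum>\<^sub>\<infinity>k. x k * y k) \<le> M * N"
proof -
  have "cmod (\<Sum>\<^sub>\<infinity>k. x k * y k) \<le> (\<Sum>\<^sub>\<infinity>k. cmod (x k * y k))"
    using l2_le_mult_abs_summable[OF assms] by (rule norm_infsum_bound)
  also have "\<dots> \<le> M * N"
    using l2_le_mult_abs_summable[OF assms]
    by (rule infsum_le_finite_sums) (rule l2_le_mult_sum[OF assms])
  finally show ?thesis .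
qed

text \<open>Enlarging a finite set of pairs to the rectangle of its two projections makes the sum of
  squares factor.\<close>

lemma l2_le_prod:
  assumes "l2_le x M" "l2_le y N"
  shows "l2_le (\<lambda>(j, k). x j * y k) (M * N)"
proof (rule l2_leI)
  fix F :: "('a \<times> 'b) set" assume F: "finite F"
  have "(\<Sum>(j, k)\<in>F. (cmod (x j * y k))\<^sup>2) \<le> (\<Sum>(j, k)\<in>fst ` F \<times> snd ` F. (cmod (x j * y k))\<^sup>2)"
    using F by (intro sum_mono2 subset_fst_snd) auto
  also have "\<dots> = (\<Sum>j\<in>fst ` F. (cmod (x j))\<^sup>2) * (\<Sum>k\<in>snd ` F. (cmod (y k))\<^sup>2)"
    by (simp add: sum.cartesian_product[symmetric] sum_product norm_mult power_mult_distrib)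
  finally have "L2_set (\<lambda>p. cmod (case p of (j, k) \<Rightarrow> x j * y k)) F
      \<le> L2_set (\<lambda>j. cmod (x j)) (fst ` F) * L2_set (\<lambda>k. cmod (y k)) (snd ` F)"
    unfolding L2_set_def by (simp flip: real_sqrt_mult add: case_prod_unfold)
  also have "\<dots> \<le> M * N"
    using assms by (intro mult_mono l2_leD) (auto intro: l2_le_nonneg)
  finally show "L2_set (\<lambda>p. cmod (case p of (j, k) \<Rightarrow> x j * y k)) F \<le> M * N" .
qed

text \<open>The bound is given for every finite \<open>G\<close> above \<open>F\<close>, which
  serves both convergence along finite subsets and convergence along initial segments.\<close>

lemma l2_le_tail:
  assumes x: "l2_le x M" and "\<epsilon> > 0"
  obtains F where "finite F" "\<And>G. finite G \<Longrightarrow> F \<subseteq> G \<Longrightarrow> l2_le (\<lambda>k. if k \<in> G then 0 else x k) \<epsilon>"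
proof -
  let ?q = "\<lambda>k. (cmod (x k))\<^sup>2"
  let ?S = "SUP F\<in>Collect finite. sum ?q F"
  have bdd: "bdd_above (sum ?q ` Collect finite)"
    by (rule bdd_aboveI2) (rule l2_le_sum_squares[OF x])
  \<comment> \<open>A finite \<open>F\<close> that misses the supremum of the partial sums of
    squares by less than \<open>\<epsilon>\<^sup>2\<close> works: any finite set disjoint from
    \<open>F\<close> can only add what is missing.\<close>
  have "?S - \<epsilon>\<^sup>2 < ?S" using \<open>\<epsilon> > 0\<close> by simp
  then obtain F where F: "finite F" "?S - \<epsilon>\<^sup>2 < sum ?q F"
    using bdd by (subst (asm) less_cSUP_iff) auto
  have "l2_le (\<lambda>k. if k \<in> G then 0 else x k) \<epsilon>" if G: "finite G" "F \<subseteq> G" for G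
  proof (rule l2_leI)
    fix H :: "'a set" assume H: "finite H"
    have "(\<Sum>k\<in>H. (cmod (if k \<in> G then 0 else x k))\<^sup>2) = sum ?q (H - G)"
      using H by (intro sum.mono_neutral_cong_right) auto
    moreover have "sum ?q (H - G) + sum ?q F = sum ?q ((H - G) \<union> F)"
      using H F G by (intro sum.union_disjoint[symmetric]) auto
    moreover have "sum ?q ((H - G) \<union> F) \<le> ?S"
      using bdd H F by (intro cSUP_upper) auto
    ultimately have "(\<Sum>k\<in>H. (cmod (if k \<in> G then 0 else x k))\<^sup>2) \<le> \<epsilon>\<^sup>2"
      using F by linarith
    then show "L2_set (\<lambda>k. cmod (if k \<in> G then 0 else x k)) H \<le> \<epsilon>"
      unfolding L2_set_def using \<open>\<epsilon> > 0\<close> by (simp add: real_le_lsqrt)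
  qed
  with F that show ?thesis by blast
qed

lemma l2_le_sum:
  assumes "finite I" "\<And>i. i \<in> I \<Longrightarrow> l2_le (x i) (M i)"
  shows "l2_le (\<lambda>k. \<Sum>i\<in>I. x i k) (\<Sum>i\<in>I. M i)"
  using assms
proof (induction I)
  case empty
  show ?case by (simp add: l2_le_def L2_set_def)
next
  case (insert i I)
  then show ?case by (simp add: l2_le_add)
qed

text \<open>Lower semicontinuity of the l2 norm under pointwise convergence, as in Fatou's lemma:
  each finite partial norm is continuous.\<close>

lemma l2_le_limit:
  assumes "F \<noteq> bot" "\<And>k. ((\<lambda>n. x n k) \<longlongrightarrow> y k) F" "(M \<longlongrightarrow> N) F" "\<And>n. l2_le (x n) (M n)"
  shows "l2_le y N"
proof (rule l2_leI)
  fix G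
  have "((\<lambda>n. L2_set (\<lambda>k. cmod (x n k)) G) \<longlongrightarrow> L2_set (\<lambda>k. cmod (y k)) G) F"
    unfolding L2_set_def by (intro tendsto_intros assms)
  with assms(1,3) show "L2_set (\<lambda>k. cmod (y k)) G \<le> N"
    by (rule tendsto_le) (simp_all add: l2_leD assms)
qed

lemma l2_le_mult_infsum_tendsto:
  assumes x: "\<And>n. l2_le (\<lambda>k. x n k - x' k) (\<delta> n)" "\<delta> \<longlonglongrightarrow> 0" "l2_le x' M"
    and y: "\<And>n. l2_le (\<lambda>k. y n k - y' k) (\<epsilon> n)" "\<epsilon> \<longlonglongrightarrow> 0" "l2_le y' N"
  shows "(\<lambda>n. \<Sum>\<^sub>\<infinity>k. x n k * y n k) \<longlonglongrightarrow> (\<Sum>\<^sub>\<infinity>k. x' k * y' k)"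
proof (rule LIM_zero_cancel, rule Lim_null_comparison)
  \<comment> \<open>The majorant comes from xy - x'y' = (x - x')y + x'(y - y'), where the norm of y
    is at most \<open>\<epsilon> n + N\<close>.\<close>
  show "(\<lambda>n. \<delta> n * (\<epsilon> n + N) + M * \<epsilon> n) \<longlonglongrightarrow> 0"
    by (rule tendsto_eq_intros x y refl | simp)+
  show "\<forall>\<^sub>F n in sequentially. cmod ((\<Sum>\<^sub>\<infinity>k. x n k * y n k) - (\<Sum>\<^sub>\<infinity>k. x' k * y' k))
      \<le> \<delta> n * (\<epsilon> n + N) + M * \<epsilon> n"
  proof (rule always_eventually, rule allI)
    fix n
    have yn: "l2_le (y n) (\<epsilon> n + N)"
      using l2_le_add[OF y(1,3)] by simp
    have "(\<Sum>\<^sub>\<infinity>k. x n k * y n k) =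
        (\<Sum>\<^sub>\<infinity>k. ((x n k - x' k) * y n k + x' k * (y n k - y' k)) + x' k * y' k)"
      by (simp add: algebra_simps)
    also have "\<dots> = (\<Sum>\<^sub>\<infinity>k. (x n k - x' k) * y n k) + (\<Sum>\<^sub>\<infinity>k. x' k * (y n k - y' k))
        + (\<Sum>\<^sub>\<infinity>k. x' k * y' k)"
      by (simp add: infsum_add summable_on_add l2_le_mult_summable[OF x(1) yn]
          l2_le_mult_summable[OF x(3) y(1)] l2_le_mult_summable[OF x(3) y(3)])
    finally have "cmod ((\<Sum>\<^sub>\<infinity>k. x n k * y n k) - (\<Sum>\<^sub>\<infinity>k. x' k * y' k)) \<le>
        cmod (\<Sum>\<^sub>\<infinity>k. (x n k - x' k) * y n k) + cmod (\<Sum>\<^sub>\<infinity>k. x' k * (y n k - y' k))"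
      by (simp add: norm_triangle_ineq)
    also have "\<dots> \<le> \<delta> n * (\<epsilon> n + N) + M * \<epsilon> n"
      by (intro add_mono l2_le_mult_infsum x y yn)
    finally show "cmod ((\<Sum>\<^sub>\<infinity>k. x n k * y n k) - (\<Sum>\<^sub>\<infinity>k. x' k * y' k))
      \<le> \<delta> n * (\<epsilon> n + N) + M * \<epsilon> n" .
  qed
qed

section \<open>Bounded functionals on l2 and the Riesz representation\<close>

locale l2_functional =
  fixes \<Lambda> :: "('k \<Rightarrow> complex) \<Rightarrow> complex" and K :: real
  assumes add: "\<And>x y M N. l2_le x M \<Longrightarrow> l2_le y N \<Longrightarrow> \<Lambda> (\<lambda>k. x k + y k) = \<Lambda> x + \<Lambda> y"
    and scale: "\<And>x M c. l2_le x M \<Longrightarrow> \<Lambda> (\<lambda>k. c * x k) = c * \<Lambda> x"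
    and bound: "\<And>x M. l2_le x M \<Longrightarrow> cmod (\<Lambda> x) \<le> K * M"
begin

lemma finite_sum:
  assumes "finite F"
  shows "\<Lambda> (\<lambda>k. if k \<in> F then x k else 0) = (\<Sum>k\<in>F. x k * \<Lambda> (unit_seq k))"
  using assms
proof (induction F)
  case empty
  show ?case using scale[OF l2_le_unit_seq, of 0] by simp
next
  case (insert j F)
  have "\<Lambda> (\<lambda>k. if k \<in> insert j F then x k else 0) =
      \<Lambda> (\<lambda>k. x j * unit_seq j k + (if k \<in> F then x k else 0))"
    using insert by (intro arg_cong[where f = \<Lambda>]) (auto simp: unit_seq_def)
  also have "\<dots> = x j * \<Lambda> (unit_seq j) + \<Lambda> (\<lambda>k. if k \<in> F then x k else 0)"
    by (subst add[OF l2_le_scale[OF l2_le_unit_seq] l2_le_restrict[OF insert(1)]])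
      (simp add: scale[OF l2_le_unit_seq])
  finally show ?case using insert by simp
qed

lemma bound_nonneg: "0 \<le> K"
  using order_trans[OF norm_ge_zero bound[OF l2_le_unit_seq]] by simp

text \<open>Testing the functional on its own conjugated and truncated coefficients gives
  \<open>?L\<^sup>2 \<le> K * ?L\<close>, and \<open>?L\<close> cancels unless it is 0.\<close>

lemma l2_le_coefficients: "l2_le (\<lambda>k. \<Lambda> (unit_seq k)) K"
proof (rule l2_leI)
  fix F :: "'k set" assume F: "finite F"
  let ?\<gamma> = "\<lambda>k. \<Lambda> (unit_seq k)"
  let ?L = "L2_set (\<lambda>k. cmod (?\<gamma> k)) F"
  have "\<Lambda> (\<lambda>k. if k \<in> F then cnj (?\<gamma> k) else 0) = (\<Sum>k\<in>F. cnj (?\<gamma> k) * ?\<gamma> k)"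
    by (rule finite_sum[OF F])
  also have "\<dots> = (\<Sum>k\<in>F. complex_of_real ((cmod (?\<gamma> k))\<^sup>2))"
    by (simp only: complex_norm_square mult.commute)
  also have "\<dots> = complex_of_real (?L\<^sup>2)"
    by (simp add: L2_set_def sum_nonneg)
  finally have "?L\<^sup>2 = cmod (\<Lambda> (\<lambda>k. if k \<in> F then cnj (?\<gamma> k) else 0))"
    by (simp add: norm_power)
  also have "\<dots> \<le> K * ?L"
    using bound[OF l2_le_restrict[OF F, of "\<lambda>k. cnj (?\<gamma> k)"]] by simp
  finally have "?L * ?L \<le> K * ?L" by (simp add: power2_eq_square)
  then show "?L \<le> K"
    using bound_nonneg by (cases "?L = 0") (auto dest: mult_right_le_imp_le simp: order_less_le)
qed

lemma expansion:
  assumes x: "l2_le x M"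
  shows "((\<lambda>k. x k * \<Lambda> (unit_seq k)) has_sum \<Lambda> x) UNIV"
  unfolding has_sum_def
proof (rule tendstoI)
  fix r :: real assume "r > 0"
  \<comment> \<open>The summand 1 keeps the denominator positive when \<open>K\<close> is 0 and
    makes \<open>K * \<epsilon>\<close> strictly smaller than \<open>r\<close>.\<close>
  define \<epsilon> where "\<epsilon> = r / (K + 1)"
  have "\<epsilon> > 0" using \<open>r > 0\<close> bound_nonneg by (simp add: \<epsilon>_def)
  then obtain F where F: "finite F"
    "\<And>G. finite G \<Longrightarrow> F \<subseteq> G \<Longrightarrow> l2_le (\<lambda>k. if k \<in> G then 0 else x k) \<epsilon>"
    using l2_le_tail[OF x] by metis
  have "dist (\<Sum>k\<in>G. x k * \<Lambda> (unit_seq k)) (\<Lambda> x) < r" if G: "finite G" "F \<subseteq> G" for G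
  proof -
    note tail = F(2)[OF G]
    have "\<Lambda> x = \<Lambda> (\<lambda>k. (if k \<in> G then x k else 0) + (if k \<in> G then 0 else x k))"
      by (intro arg_cong[where f = \<Lambda>]) auto
    also have "\<dots> = (\<Sum>k\<in>G. x k * \<Lambda> (unit_seq k)) + \<Lambda> (\<lambda>k. if k \<in> G then 0 else x k)"
      by (simp only: add[OF l2_le_restrict[OF G(1)] tail] finite_sum[OF G(1)])
    finally have "dist (\<Sum>k\<in>G. x k * \<Lambda> (unit_seq k)) (\<Lambda> x) \<le> K * \<epsilon>"
      using bound[OF tail] by (simp add: dist_norm)
    also have "\<dots> < r"
      using \<open>r > 0\<close> bound_nonneg by (simp add: \<epsilon>_def field_simps)
    finally show ?thesis .
  qed
  with F(1) show "\<forall>\<^sub>F G in finite_subsets_at_top UNIV.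
      dist (\<Sum>k\<in>G. x k * \<Lambda> (unit_seq k)) (\<Lambda> x) < r"
    unfolding eventually_finite_subsets_at_top by auto
qed

end

section \<open>Algebras with square-summable coordinates\<close>

text \<open>\<open>mult_expansion\<close> ranges over all linear forms bounded on the carrier rather
  than over members of \<open>dual A\<close>. It thus applies directly to partial functionals such
  as \<open>\<lambda>a. \<omega> (el a y)\<close>, which follow no convention outside the
  carrier.\<close>

locale coordinates =
  fixes A :: "('a, 'm) calgebra_scheme"
    and c :: "'k \<Rightarrow> 'a \<Rightarrow> complex"
    and E :: "'k \<Rightarrow> 'a"
  assumes add_closed: "a \<in> vcarrier A \<Longrightarrow> b \<in> vcarrier A \<Longrightarrow> vadd A a b \<in> vcarrier A"
    and scale_closed: "a \<in> vcarrier A \<Longrightarrow> vscale A z a \<in> vcarrier A"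
    and coord_linear: "linear_form A (c k)"
    and coord_l2: "a \<in> vcarrier A \<Longrightarrow> l2_le (\<lambda>k. c k a) (vnorm A a)"
    and unit_carrier: "E k \<in> vcarrier A"
    and unit_norm: "vnorm A (E k) \<le> 1"
    and mult_expansion:
      "\<lbrakk>linear_form A \<omega>; \<And>a. a \<in> vcarrier A \<Longrightarrow> cmod (\<omega> a) \<le> K * vnorm A a;
        a \<in> vcarrier A; b \<in> vcarrier A\<rbrakk>
       \<Longrightarrow> ((\<lambda>k. \<omega> (E k) * (c k a * c k b)) has_sum \<omega> (vmult A a b)) UNIV"
begin

lemma norm_nonneg: "a \<in> vcarrier A \<Longrightarrow> 0 \<le> vnorm A a"
  by (rule l2_le_nonneg[OF coord_l2])

lemma coord_add:
  "a \<in> vcarrier A \<Longrightarrow> b \<in> vcarrier A \<Longrightarrow> c k (vadd A a b) = c k a + c k b"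
  using coord_linear by (auto simp: linear_form_def)

lemma coord_scale: "a \<in> vcarrier A \<Longrightarrow> c k (vscale A z a) = z * c k a"
  using coord_linear by (auto simp: linear_form_def)

lemma bounded_on_units:
  assumes "\<And>a. a \<in> vcarrier A \<Longrightarrow> cmod (\<omega> a) \<le> K * vnorm A a"
  shows "cmod (\<omega> (E k)) \<le> \<bar>K\<bar>"
proof -
  have "cmod (\<omega> (E k)) \<le> K * vnorm A (E k)"
    using assms unit_carrier by blast
  \<comment> \<open>The absolute value is taken because the constant in the definition of
    \<open>dual\<close> has no prescribed sign.\<close>
  also have "\<dots> \<le> \<bar>K\<bar> * 1"
    using norm_nonneg[OF unit_carrier] unit_norm by (intro mult_mono) auto
  finally show ?thesis by simp
qed

text \<open>The transpose of the coordinate map into l2. The value 0 outside the carrier matches the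
  convention of \<open>dual\<close>, so that functionals can be compared as functions.\<close>

definition coord_form :: "('k \<Rightarrow> complex) \<Rightarrow> 'a \<Rightarrow> complex" where
  "coord_form \<xi> = (\<lambda>a. if a \<in> vcarrier A then \<Sum>\<^sub>\<infinity>k. \<xi> k * c k a else 0)"

lemma coord_form_bound:
  "l2_le \<xi> M \<Longrightarrow> a \<in> vcarrier A \<Longrightarrow> cmod (coord_form \<xi> a) \<le> M * vnorm A a"
  by (simp add: coord_form_def l2_le_mult_infsum coord_l2)

lemma coord_form_dual:
  assumes "l2_le \<xi> M"
  shows "coord_form \<xi> \<in> vcarrier (dual A)"
proof -
  have "linear_form A (coord_form \<xi>)"
    unfolding linear_form_def
    by (auto simp: coord_form_def add_closed scale_closed coord_add coord_scale distrib_left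
        mult.left_commute infsum_add infsum_cmult_right' l2_le_mult_summable[OF assms coord_l2])
  moreover have "\<exists>K. \<forall>a\<in>vcarrier A. cmod (coord_form \<xi> a) \<le> K * vnorm A a"
    using coord_form_bound[OF assms] by blast
  ultimately show ?thesis
    by (simp add: dual_def) (simp add: coord_form_def)
qed

lemma coord_form_norm:
  assumes "l2_le \<xi> M"
  shows "0 \<le> vnorm (dual A) (coord_form \<xi>)" "vnorm (dual A) (coord_form \<xi>) \<le> M"
proof -
  let ?S = "{cmod (coord_form \<xi> a) |a. a \<in> vcarrier A \<and> vnorm A a \<le> 1}"
  have ub: "s \<le> M" if "s \<in> ?S" for s
  proof -
    from that obtain a where a: "a \<in> vcarrier A" "vnorm A a \<le> 1" "s = cmod (coord_form \<xi> a)"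
      by auto
    have "s \<le> M * vnorm A a"
      using coord_form_bound[OF assms a(1)] a(3) by simp
    also have "\<dots> \<le> M"
      using a(2) l2_le_nonneg[OF assms] by (simp add: mult_left_le)
    finally show ?thesis .
  qed
  \<comment> \<open>Any index would do: the witness makes the set nonempty, as both estimates of its
    supremum require.\<close>
  have mem: "cmod (coord_form \<xi> (E undefined)) \<in> ?S"
    using unit_carrier unit_norm by blast
  show "vnorm (dual A) (coord_form \<xi>) \<le> M"
    unfolding dual_def using mem ub by (auto intro!: cSup_least)
  have "cmod (coord_form \<xi> (E undefined)) \<le> Sup ?S"
    using mem ub by (intro cSup_upper bdd_aboveI) auto
  then show "0 \<le> vnorm (dual A) (coord_form \<xi>)"
    unfolding dual_def by (simp add: order_trans[OF norm_ge_zero])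
qed

lemma coord_form_add:
  "l2_le \<xi> M \<Longrightarrow> l2_le \<eta> N \<Longrightarrow>
   coord_form (\<lambda>k. \<xi> k + \<eta> k) = vadd (dual A) (coord_form \<xi>) (coord_form \<eta>)"
  by (rule ext)
    (auto simp: coord_form_def dual_def distrib_right
      intro!: infsum_add l2_le_mult_summable[OF _ coord_l2])

lemma coord_form_scale: "coord_form (\<lambda>k. z * \<xi> k) = vscale (dual A) z (coord_form \<xi>)"
  by (rule ext) (simp add: coord_form_def dual_def mult.assoc infsum_cmult_right')

text \<open>Composing \<open>g\<close> with the bounded transpose \<open>coord_form\<close> gives a
  bounded functional on l2, which brings the Riesz representation into play.\<close>

lemma bidual_l2_functional:
  assumes "g \<in> vcarrier (bidual A)"
  obtains K where "l2_functional (\<lambda>\<xi>. g (coord_form \<xi>)) K"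
proof -
  have lin: "linear_form (dual A) g"
    using assms by (simp add: dual_def[of "dual A"])
  obtain K where K: "\<And>\<omega>. \<omega> \<in> vcarrier (dual A) \<Longrightarrow> cmod (g \<omega>) \<le> K * vnorm (dual A) \<omega>"
    using assms by (auto simp: dual_def[of "dual A"])
  have "cmod (g (coord_form \<xi>)) \<le> \<bar>K\<bar> * M" if "l2_le \<xi> M" for \<xi> M
  proof -
    have "cmod (g (coord_form \<xi>)) \<le> K * vnorm (dual A) (coord_form \<xi>)"
      using that by (intro K coord_form_dual)
    also have "\<dots> \<le> \<bar>K\<bar> * M"
      using coord_form_norm[OF that] by (intro mult_mono) auto
    finally show ?thesis .
  qed
  then have "l2_functional (\<lambda>\<xi>. g (coord_form \<xi>)) \<bar>K\<bar>"
    using lin coord_form_dual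
    by unfold_locales (auto simp: coord_form_add coord_form_scale linear_form_def)
  then show ?thesis by (rule that)
qed

text \<open>The expansion of a product under \<open>\<omega>\<close> is symmetric in the two
  factors, so the left and right translates coincide. Their coefficients are square summable as a
  bounded multiple of the coordinates of \<open>a\<close>.\<close>

lemma mult_form:
  assumes "\<omega> \<in> vcarrier (dual A)" "a \<in> vcarrier A"
  shows "mult_left A \<omega> a = coord_form (\<lambda>k. \<omega> (E k) * c k a)"
    and "mult_right A a \<omega> = coord_form (\<lambda>k. \<omega> (E k) * c k a)"
proof -
  obtain K where K: "linear_form A \<omega>" "\<And>a. a \<in> vcarrier A \<Longrightarrow> cmod (\<omega> a) \<le> K * vnorm A a"
    using assms(1) by (auto simp: dual_def)
  have "\<omega> (vmult A a b) = (\<Sum>\<^sub>\<infinity>k. \<omega> (E k) * c k a * c k b)"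
    and "\<omega> (vmult A b a) = (\<Sum>\<^sub>\<infinity>k. \<omega> (E k) * c k a * c k b)" if "b \<in> vcarrier A" for b
    using infsumI[OF mult_expansion[OF K assms(2) that]] infsumI[OF mult_expansion[OF K that assms(2)]]
    by (simp_all add: mult_ac)
  then show "mult_left A \<omega> a = coord_form (\<lambda>k. \<omega> (E k) * c k a)"
    and "mult_right A a \<omega> = coord_form (\<lambda>k. \<omega> (E k) * c k a)"
    by (auto simp: mult_left_def mult_right_def coord_form_def)
qed

text \<open>Expanding \<open>g\<close> at the square-summable family
  \<open>\<omega> (E k) * c k a\<close> and regrouping exhibits the result as a coordinate form in
  \<open>a\<close>, with the Riesz coefficients of \<open>g\<close> in place of the coordinates of
  an element.\<close>

lemma bidual_mult_form:
  assumes "\<omega> \<in> vcarrier (dual A)" "g \<in> vcarrier (bidual A)"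
  shows "bidual_right A g \<omega> = coord_form (\<lambda>k. \<omega> (E k) * g (coord_form (unit_seq k)))"
    and "bidual_left A \<omega> g = coord_form (\<lambda>k. \<omega> (E k) * g (coord_form (unit_seq k)))"
proof -
  obtain K where K: "\<And>a. a \<in> vcarrier A \<Longrightarrow> cmod (\<omega> a) \<le> K * vnorm A a"
    using assms(1) by (auto simp: dual_def)
  have w: "cmod (\<omega> (E k)) \<le> \<bar>K\<bar>" for k
    by (rule bounded_on_units[OF K])
  obtain L where "l2_functional (\<lambda>\<xi>. g (coord_form \<xi>)) L"
    using assms(2) by (rule bidual_l2_functional)
  then interpret g: l2_functional "\<lambda>\<xi>. g (coord_form \<xi>)" L .
  have "g (coord_form (\<lambda>k. \<omega> (E k) * c k a)) =
      (\<Sum>\<^sub>\<infinity>k. \<omega> (E k) * g (coord_form (unit_seq k)) * c k a)" if "a \<in> vcarrier A" for a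
    using infsumI[OF g.expansion[OF l2_le_bounded_mult[OF coord_l2[OF that], of "\<lambda>k. \<omega> (E k)", OF w]]]
    by (simp add: mult_ac)
  then show "bidual_right A g \<omega> = coord_form (\<lambda>k. \<omega> (E k) * g (coord_form (unit_seq k)))"
    and "bidual_left A \<omega> g = coord_form (\<lambda>k. \<omega> (E k) * g (coord_form (unit_seq k)))"
    using assms(1)
    by (auto simp: bidual_right_def bidual_left_def coord_form_def mult_form)
qed

theorem arens_regular: "arens_regular A"
  unfolding arens_regular_def
proof (intro ballI ext)
  fix f g \<omega> assume f: "f \<in> vcarrier (bidual A)" and g: "g \<in> vcarrier (bidual A)"
  show "arens_box A f g \<omega> = arens_diamond A f g \<omega>"
  proof (cases "\<omega> \<in> vcarrier (dual A)")
    case True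
    then obtain K where K: "\<And>a. a \<in> vcarrier A \<Longrightarrow> cmod (\<omega> a) \<le> K * vnorm A a"
      by (auto simp: dual_def)
    obtain L where "l2_functional (\<lambda>\<xi>. f (coord_form \<xi>)) L"
      using f by (rule bidual_l2_functional)
    then interpret f: l2_functional "\<lambda>\<xi>. f (coord_form \<xi>)" L .
    obtain L' where "l2_functional (\<lambda>\<xi>. g (coord_form \<xi>)) L'"
      using g by (rule bidual_l2_functional)
    then interpret g: l2_functional "\<lambda>\<xi>. g (coord_form \<xi>)" L' .
    note w = bounded_on_units[OF K]
    show ?thesis
      \<comment> \<open>The Riesz coefficients of \<open>g\<close> stay square summable after
        multiplication by the bounded weights, so \<open>f\<close> may be expanded there, and
        likewise with the roles exchanged. Both sums have the same terms.\<close>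
      using infsumI[OF f.expansion[OF l2_le_bounded_mult[OF g.l2_le_coefficients w]]]
        infsumI[OF g.expansion[OF l2_le_bounded_mult[OF f.l2_le_coefficients w]]]
      by (simp add: arens_box_def arens_diamond_def True bidual_mult_form f g mult_ac)
  qed (simp add: arens_box_def arens_diamond_def)
qed

end

text \<open>The added laws are those used to estimate products in the projective norm. The triangle
  inequality is left to \<open>coordinate_function_algebra\<close>, since the projective norm
  obtains its own by concatenating representations.\<close>

locale coordinate_algebra = coordinates A c E
  for A :: "('a, 'm) calgebra_scheme" and c :: "'k \<Rightarrow> 'a \<Rightarrow> complex" and E :: "'k \<Rightarrow> 'a" +
  assumes bilinear: "bilinear_mult A"
    and norm_scale: "a \<in> vcarrier A \<Longrightarrow> vnorm A (vscale A z a) \<le> cmod z * vnorm A a"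
    and norm_mult:
      "a \<in> vcarrier A \<Longrightarrow> b \<in> vcarrier A \<Longrightarrow> vnorm A (vmult A a b) \<le> vnorm A a * vnorm A b"
begin

lemma mult_closed: "a \<in> vcarrier A \<Longrightarrow> b \<in> vcarrier A \<Longrightarrow> vmult A a b \<in> vcarrier A"
  using bilinear by (simp add: bilinear_mult_def)

lemma mult_scale_right:
  "a \<in> vcarrier A \<Longrightarrow> x \<in> vcarrier A \<Longrightarrow> vmult A x (vscale A z a) = vscale A z (vmult A x a)"
  using bilinear by (simp add: bilinear_mult_def)

end

section \<open>Completions\<close>

text \<open>Pointwise operations on complex functions, as on tensors viewed as functionals on
  bilinear forms, let identities between differences be verified by arithmetic on values.\<close>

locale coordinate_function_algebra = coordinate_algebra A c E
  for A :: "('x \<Rightarrow> complex, 'm) calgebra_scheme" and c :: "'k \<Rightarrow> ('x \<Rightarrow> complex) \<Rightarrow> complex"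
    and E :: "'k \<Rightarrow> ('x \<Rightarrow> complex)" +
  assumes add_eq: "vadd A u v = (\<lambda>x. u x + v x)"
    and scale_eq: "vscale A z u = (\<lambda>x. z * u x)"
    and norm_triangle:
      "u \<in> vcarrier A \<Longrightarrow> v \<in> vcarrier A \<Longrightarrow> vnorm A (vadd A u v) \<le> vnorm A u + vnorm A v"
begin

section \<open>The distance induced by the norm, and Cauchy sequences\<close>

definition seminorm_dist :: "('x \<Rightarrow> complex) \<Rightarrow> ('x \<Rightarrow> complex) \<Rightarrow> real" where
  "seminorm_dist u v = vnorm A (vdiff A u v)"

lemma vdiff_eq: "vdiff A u v = (\<lambda>x. u x - v x)"
  by (simp add: vdiff_def add_eq scale_eq)

lemma vdiff_closed: "u \<in> vcarrier A \<Longrightarrow> v \<in> vcarrier A \<Longrightarrow> vdiff A u v \<in> vcarrier A"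
  by (simp add: vdiff_def add_closed scale_closed)

lemma dist_nonneg: "u \<in> vcarrier A \<Longrightarrow> v \<in> vcarrier A \<Longrightarrow> 0 \<le> seminorm_dist u v"
  by (simp add: seminorm_dist_def norm_nonneg vdiff_closed)

lemma dist_self:
  assumes "u \<in> vcarrier A" shows "seminorm_dist u u = 0"
proof -
  \<comment> \<open>Written as a multiple by 0, the difference has norm at most 0 by the scaling
    law.\<close>
  have "vdiff A u u = vscale A 0 u"
    by (simp add: vdiff_eq scale_eq)
  with norm_scale[OF assms, of 0] dist_nonneg[OF assms assms] show ?thesis
    by (simp add: seminorm_dist_def)
qed

lemma dist_scale:
  assumes "u \<in> vcarrier A" "v \<in> vcarrier A"
  shows "seminorm_dist (vscale A z u) (vscale A z v) \<le> cmod z * seminorm_dist u v"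
proof -
  have "vdiff A (vscale A z u) (vscale A z v) = vscale A z (vdiff A u v)"
    by (simp add: vdiff_eq scale_eq algebra_simps)
  with norm_scale[OF vdiff_closed[OF assms]] show ?thesis
    by (simp add: seminorm_dist_def)
qed

lemma dist_commute:
  assumes "u \<in> vcarrier A" "v \<in> vcarrier A"
  shows "seminorm_dist u v = seminorm_dist v u"
proof -
  have "seminorm_dist u v \<le> seminorm_dist v u" if "u \<in> vcarrier A" "v \<in> vcarrier A" for u v
  proof -
    have "vdiff A u v = vscale A (-1) (vdiff A v u)"
      by (simp add: vdiff_eq scale_eq)
    with norm_scale[OF vdiff_closed[OF that(2,1)], of "-1"] show ?thesis
      by (simp add: seminorm_dist_def)
  qed
  with assms show ?thesis by (meson order_antisym)
qed

lemma dist_triangle: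
  assumes "u \<in> vcarrier A" "v \<in> vcarrier A" "w \<in> vcarrier A"
  shows "seminorm_dist u w \<le> seminorm_dist u v + seminorm_dist v w"
proof -
  have "vdiff A u w = vadd A (vdiff A u v) (vdiff A v w)"
    by (simp add: vdiff_eq add_eq)
  with norm_triangle[OF vdiff_closed[OF assms(1,2)] vdiff_closed[OF assms(2,3)]] show ?thesis
    by (simp add: seminorm_dist_def)
qed

lemma dist_norm:
  assumes "u \<in> vcarrier A" "v \<in> vcarrier A"
  shows "\<bar>vnorm A u - vnorm A v\<bar> \<le> seminorm_dist u v"
proof -
  have "vnorm A u - vnorm A v \<le> seminorm_dist u v" if "u \<in> vcarrier A" "v \<in> vcarrier A" for u v
  proof -
    have "u = vadd A (vdiff A u v) v"
      by (simp add: vdiff_eq add_eq)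
    with norm_triangle[OF vdiff_closed[OF that] that(2)] show ?thesis
      by (simp add: seminorm_dist_def)
  qed
  from this[OF assms] this[OF assms(2,1)] dist_commute[OF assms] show ?thesis by simp
qed

lemma dist_add:
  assumes "u \<in> vcarrier A" "v \<in> vcarrier A" "u' \<in> vcarrier A" "v' \<in> vcarrier A"
  shows "seminorm_dist (vadd A u u') (vadd A v v') \<le> seminorm_dist u v + seminorm_dist u' v'"
proof -
  have "vdiff A (vadd A u u') (vadd A v v') = vadd A (vdiff A u v) (vdiff A u' v')"
    by (simp add: vdiff_eq add_eq algebra_simps)
  with norm_triangle[OF vdiff_closed[OF assms(1,2)] vdiff_closed[OF assms(3,4)]] show ?thesis
    by (simp add: seminorm_dist_def)
qed

text \<open>The usual splitting uu' - vv' = u(u' - v') + (u - v)v'.\<close>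

lemma dist_mult:
  assumes "u \<in> vcarrier A" "v \<in> vcarrier A" "u' \<in> vcarrier A" "v' \<in> vcarrier A"
  shows "seminorm_dist (vmult A u u') (vmult A v v') \<le>
    vnorm A u * seminorm_dist u' v' + seminorm_dist u v * vnorm A v'"
proof -
  let ?d = "vdiff A"
  note m = bilinear[unfolded bilinear_mult_def, rule_format]
  have "vmult A u (?d u' v') = vadd A (vmult A u u') (vscale A (-1) (vmult A u v'))"
    unfolding vdiff_def using assms by (simp add: m scale_closed)
  moreover have "vmult A (?d u v) v' = vadd A (vmult A u v') (vscale A (-1) (vmult A v v'))"
    unfolding vdiff_def using assms by (simp add: m scale_closed)
  ultimately have eq: "?d (vmult A u u') (vmult A v v') =
      vadd A (vmult A u (?d u' v')) (vmult A (?d u v) v')"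
    by (simp add: vdiff_eq add_eq scale_eq)
  have "vnorm A (?d (vmult A u u') (vmult A v v')) \<le>
      vnorm A (vmult A u (?d u' v')) + vnorm A (vmult A (?d u v) v')"
    unfolding eq by (intro norm_triangle mult_closed vdiff_closed assms)
  also have "\<dots> \<le> vnorm A u * vnorm A (?d u' v') + vnorm A (?d u v) * vnorm A v'"
    by (intro add_mono norm_mult vdiff_closed assms)
  finally show ?thesis by (simp add: seminorm_dist_def)
qed

text \<open>As convergence to 0 along a product filter, the Cauchy condition can be proved by the
  same comparison arguments as the null condition in \<open>null_rel\<close>.\<close>

lemma cauchy_seqs_iff:
  "s \<in> cauchy_seqs A \<longleftrightarrow> (\<forall>n. s n \<in> vcarrier A) \<and>
     ((\<lambda>(m, n). seminorm_dist (s m) (s n)) \<longlongrightarrow> 0) (sequentially \<times>\<^sub>F sequentially)"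
proof (cases "\<forall>n. s n \<in> vcarrier A")
  case True
  then show ?thesis
    unfolding cauchy_seqs_def tendsto_iff
    by (auto simp: eventually_prod_sequentially seminorm_dist_def[symmetric] dist_nonneg dist_commute)
qed (auto simp: cauchy_seqs_def)

lemma cauchy_seqs_carrier: "s \<in> cauchy_seqs A \<Longrightarrow> s n \<in> vcarrier A"
  by (simp add: cauchy_seqs_iff)

lemma null_rel_iff:
  "(s, t) \<in> null_rel A \<longleftrightarrow> s \<in> cauchy_seqs A \<and> t \<in> cauchy_seqs A \<and>
     (\<lambda>n. seminorm_dist (s n) (t n)) \<longlonglongrightarrow> 0"
  by (simp add: null_rel_def seminorm_dist_def)

lemma const_cauchy: "u \<in> vcarrier A \<Longrightarrow> (\<lambda>_. u) \<in> cauchy_seqs A"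
  by (simp add: cauchy_seqs_iff dist_self case_prod_unfold)

lemma equiv_null_rel: "equiv (cauchy_seqs A) (null_rel A)"
proof (rule equivI)
  show "null_rel A \<subseteq> cauchy_seqs A \<times> cauchy_seqs A"
    by (auto simp: null_rel_iff)
  show "refl_on (cauchy_seqs A) (null_rel A)"
    by (auto simp: refl_on_def null_rel_iff dist_self cauchy_seqs_carrier)
  show "sym (null_rel A)"
    by (auto simp: sym_def null_rel_iff dist_commute cauchy_seqs_carrier)
  show "trans (null_rel A)"
  proof (rule transI)
    fix s t r assume st: "(s, t) \<in> null_rel A" and tr: "(t, r) \<in> null_rel A"
    note car = st[unfolded null_rel_iff] tr[unfolded null_rel_iff]
    have "(\<lambda>n. seminorm_dist (s n) (r n)) \<longlonglongrightarrow> 0"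
    proof (rule Lim_null_comparison)
      show "(\<lambda>n. seminorm_dist (s n) (t n) + seminorm_dist (t n) (r n)) \<longlonglongrightarrow> 0"
        using car by (auto intro: tendsto_add_zero)
      show "\<forall>\<^sub>F n in sequentially. norm (seminorm_dist (s n) (r n)) \<le>
          seminorm_dist (s n) (t n) + seminorm_dist (t n) (r n)"
        using car by (intro always_eventually) (auto simp: dist_nonneg cauchy_seqs_carrier
            intro!: dist_triangle)
    qed
    with car show "(s, r) \<in> null_rel A" by (simp add: null_rel_iff)
  qed
qed

lemma norm_convergent:
  assumes "s \<in> cauchy_seqs A"
  shows "convergent (\<lambda>n. vnorm A (s n))"
proof (rule Cauchy_convergent, rule metric_CauchyI)
  fix \<epsilon> :: real assume "\<epsilon> > 0"
  then obtain N where N: "\<And>m n. m \<ge> N \<Longrightarrow> n \<ge> N \<Longrightarrow> seminorm_dist (s m) (s n) < \<epsilon>"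
    using assms unfolding cauchy_seqs_def seminorm_dist_def by blast
  show "\<exists>N. \<forall>m\<ge>N. \<forall>n\<ge>N. dist (vnorm A (s m)) (vnorm A (s n)) < \<epsilon>"
    unfolding dist_real_def
    using N dist_norm[OF cauchy_seqs_carrier[OF assms] cauchy_seqs_carrier[OF assms]]
    by (meson le_less_trans)
qed

text \<open>Multiplication is uniformly continuous on bounded sets; this bound is what makes
  products of Cauchy sequences Cauchy.\<close>

lemma norm_le_bound:
  assumes "s \<in> cauchy_seqs A"
  obtains B where "\<And>n. vnorm A (s n) \<le> B"
proof -
  from norm_convergent[OF assms] have "Bseq (\<lambda>n. vnorm A (s n))"
    by (rule convergent_imp_Bseq)
  then obtain B where "\<And>n. norm (vnorm A (s n)) \<le> B"
    by (auto simp: Bseq_def)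
  then show ?thesis
    using that[of B] by (simp add: abs_le_iff)
qed

lemma add_cauchy:
  assumes s: "s \<in> cauchy_seqs A" and t: "t \<in> cauchy_seqs A"
  shows "(\<lambda>n. vadd A (s n) (t n)) \<in> cauchy_seqs A"
proof -
  have "((\<lambda>(m, n). seminorm_dist (vadd A (s m) (t m)) (vadd A (s n) (t n))) \<longlongrightarrow> 0)
      (sequentially \<times>\<^sub>F sequentially)"
  proof (rule Lim_null_comparison)
    show "((\<lambda>(m, n). seminorm_dist (s m) (s n) + seminorm_dist (t m) (t n)) \<longlongrightarrow> 0)
        (sequentially \<times>\<^sub>F sequentially)"
      using assms by (auto simp: cauchy_seqs_iff case_prod_unfold intro: tendsto_add_zero)
  qed (use cauchy_seqs_carrier[OF s] cauchy_seqs_carrier[OF t] in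
      \<open>auto intro!: always_eventually dist_add simp: dist_nonneg add_closed\<close>)
  with assms show ?thesis
    by (simp add: cauchy_seqs_iff add_closed)
qed

lemma scale_cauchy:
  assumes s: "s \<in> cauchy_seqs A"
  shows "(\<lambda>n. vscale A z (s n)) \<in> cauchy_seqs A"
proof -
  have "((\<lambda>(m, n). seminorm_dist (vscale A z (s m)) (vscale A z (s n))) \<longlongrightarrow> 0)
      (sequentially \<times>\<^sub>F sequentially)"
  proof (rule Lim_null_comparison)
    show "((\<lambda>(m, n). cmod z * seminorm_dist (s m) (s n)) \<longlongrightarrow> 0)
        (sequentially \<times>\<^sub>F sequentially)"
      using assms by (auto simp: cauchy_seqs_iff case_prod_unfold intro: tendsto_mult_right_zero)
  qed (use cauchy_seqs_carrier[OF s] in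
      \<open>auto intro!: always_eventually dist_scale simp: dist_nonneg scale_closed\<close>)
  with assms show ?thesis
    by (simp add: cauchy_seqs_iff scale_closed)
qed

lemma dist_mult_bound:
  assumes "u \<in> vcarrier A" "v \<in> vcarrier A" "u' \<in> vcarrier A" "v' \<in> vcarrier A"
    and "vnorm A u \<le> B" "vnorm A v' \<le> B'"
  shows "seminorm_dist (vmult A u u') (vmult A v v') \<le>
    B * seminorm_dist u' v' + seminorm_dist u v * B'"
proof -
  note dist_mult[OF assms(1-4)]
  also have "vnorm A u * seminorm_dist u' v' + seminorm_dist u v * vnorm A v' \<le>
      B * seminorm_dist u' v' + seminorm_dist u v * B'"
    using assms by (intro add_mono mult_left_mono mult_right_mono dist_nonneg)
  finally show ?thesis .
qed

lemma mult_cauchy: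
  assumes s: "s \<in> cauchy_seqs A" and t: "t \<in> cauchy_seqs A"
  shows "(\<lambda>n. vmult A (s n) (t n)) \<in> cauchy_seqs A"
proof -
  obtain B where B: "\<And>n. vnorm A (s n) \<le> B" using norm_le_bound[OF s] by blast
  obtain B' where B': "\<And>n. vnorm A (t n) \<le> B'" using norm_le_bound[OF t] by blast
  have "((\<lambda>(m, n). seminorm_dist (vmult A (s m) (t m)) (vmult A (s n) (t n))) \<longlongrightarrow> 0)
      (sequentially \<times>\<^sub>F sequentially)"
  proof (rule Lim_null_comparison)
    show "((\<lambda>(m, n). B * seminorm_dist (t m) (t n) + seminorm_dist (s m) (s n) * B') \<longlongrightarrow> 0)
        (sequentially \<times>\<^sub>F sequentially)"
      using assms unfolding cauchy_seqs_iff case_prod_unfold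
      by (auto intro!: tendsto_add_zero tendsto_mult_right_zero tendsto_mult_left_zero)
  qed (use cauchy_seqs_carrier[OF s] cauchy_seqs_carrier[OF t] B B' in
      \<open>auto intro!: always_eventually dist_mult_bound simp: dist_nonneg mult_closed\<close>)
  with assms show ?thesis
    by (simp add: cauchy_seqs_iff mult_closed)
qed

section \<open>Operations and norm on classes of Cauchy sequences\<close>

definition cls :: "(nat \<Rightarrow> 'x \<Rightarrow> complex) \<Rightarrow> (nat \<Rightarrow> 'x \<Rightarrow> complex) set" where
  "cls s = null_rel A `` {s}"

lemma cls_eqI: "(s, t) \<in> null_rel A \<Longrightarrow> cls t = cls s"
  unfolding cls_def using equiv_class_eq[OF equiv_null_rel] by metis

lemma mem_cls: "t \<in> cls s \<longleftrightarrow> (s, t) \<in> null_rel A"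
  by (simp add: cls_def)

lemma self_mem_cls: "s \<in> cauchy_seqs A \<Longrightarrow> s \<in> cls s"
  unfolding cls_def by (rule equiv_class_self[OF equiv_null_rel])

lemma completion_carrier: "vcarrier (completion A) = cls ` cauchy_seqs A"
  by (auto simp: completion_def quotient_def cls_def)

text \<open>When the operation respects \<open>null_rel\<close>, the union over representatives in
  \<open>completion\<close> is a union of copies of one and the same class.\<close>

lemma completion_op:
  assumes "s \<in> cauchy_seqs A" "t \<in> cauchy_seqs A"
    and "\<And>s' t'. (s, s') \<in> null_rel A \<Longrightarrow> (t, t') \<in> null_rel A \<Longrightarrow>
      (f s t, f s' t') \<in> null_rel A"
  shows "(\<Union>s'\<in>cls s. \<Union>t'\<in>cls t. cls (f s' t')) = cls (f s t)"
proof -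
  have *: "(\<Union>t'\<in>cls t. cls (f s' t')) = cls (f s t)" if "s' \<in> cls s" for s'
    by (rule UN_constant_eq[OF self_mem_cls[OF assms(2)]]) (use that assms(3) in \<open>simp add: mem_cls cls_eqI\<close>)
  show ?thesis
    by (rule UN_constant_eq[OF self_mem_cls[OF assms(1)]]) (use * in blast)
qed

lemma completion_add:
  assumes s: "s \<in> cauchy_seqs A" and t: "t \<in> cauchy_seqs A"
  shows "vadd (completion A) (cls s) (cls t) = cls (\<lambda>n. vadd A (s n) (t n))"
proof -
  have "((\<lambda>n. vadd A (s n) (t n)), (\<lambda>n. vadd A (s' n) (t' n))) \<in> null_rel A"
    if s': "(s, s') \<in> null_rel A" and t': "(t, t') \<in> null_rel A" for s' t'
  proof -
    have c: "s' \<in> cauchy_seqs A" "t' \<in> cauchy_seqs A"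
      using that by (auto simp: null_rel_iff)
    have "(\<lambda>n. seminorm_dist (vadd A (s n) (t n)) (vadd A (s' n) (t' n))) \<longlonglongrightarrow> 0"
    proof (rule Lim_null_comparison)
      show "(\<lambda>n. seminorm_dist (s n) (s' n) + seminorm_dist (t n) (t' n)) \<longlonglongrightarrow> 0"
        using that by (auto simp: null_rel_iff intro: tendsto_add_zero)
    qed (use c[THEN cauchy_seqs_carrier] cauchy_seqs_carrier[OF s] cauchy_seqs_carrier[OF t] in
        \<open>auto intro!: always_eventually dist_add simp: dist_nonneg add_closed\<close>)
    with s t c show ?thesis by (simp add: null_rel_iff add_cauchy)
  qed
  from completion_op[where f = "\<lambda>s t n. vadd A (s n) (t n)", OF s t this] show ?thesis
    by (simp add: completion_def cls_def)
qed

lemma completion_scale: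
  assumes s: "s \<in> cauchy_seqs A"
  shows "vscale (completion A) z (cls s) = cls (\<lambda>n. vscale A z (s n))"
proof -
  have "((\<lambda>n. vscale A z (s n)), (\<lambda>n. vscale A z (s' n))) \<in> null_rel A"
    if s': "(s, s') \<in> null_rel A" for s'
  proof -
    have c: "s' \<in> cauchy_seqs A"
      using that by (auto simp: null_rel_iff)
    have "(\<lambda>n. seminorm_dist (vscale A z (s n)) (vscale A z (s' n))) \<longlonglongrightarrow> 0"
    proof (rule Lim_null_comparison)
      show "(\<lambda>n. cmod z * seminorm_dist (s n) (s' n)) \<longlonglongrightarrow> 0"
        using that by (auto simp: null_rel_iff intro: tendsto_mult_right_zero)
    qed (use c[THEN cauchy_seqs_carrier] cauchy_seqs_carrier[OF s] in
        \<open>auto intro!: always_eventually dist_scale simp: dist_nonneg scale_closed\<close>)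
    with s c show ?thesis by (simp add: null_rel_iff scale_cauchy)
  qed
  then have "(\<Union>s'\<in>cls s. cls (\<lambda>n. vscale A z (s' n))) = cls (\<lambda>n. vscale A z (s n))"
    by (intro UN_constant_eq[OF self_mem_cls[OF s]]) (simp add: mem_cls cls_eqI)
  then show ?thesis
    by (simp add: completion_def cls_def)
qed

lemma completion_mult:
  assumes s: "s \<in> cauchy_seqs A" and t: "t \<in> cauchy_seqs A"
  shows "vmult (completion A) (cls s) (cls t) = cls (\<lambda>n. vmult A (s n) (t n))"
proof -
  have "((\<lambda>n. vmult A (s n) (t n)), (\<lambda>n. vmult A (s' n) (t' n))) \<in> null_rel A"
    if s': "(s, s') \<in> null_rel A" and t': "(t, t') \<in> null_rel A" for s' t'
  proof -
    have c: "s' \<in> cauchy_seqs A" "t' \<in> cauchy_seqs A"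
      using that by (auto simp: null_rel_iff)
    \<comment> \<open>The splitting in \<open>dist_mult\<close> weights the distances by the first
      left factor and the second right factor, hence bounds for \<open>s\<close> and for
      \<open>t'\<close>.\<close>
    obtain B where B: "\<And>n. vnorm A (s n) \<le> B" using norm_le_bound[OF s] by blast
    obtain B' where B': "\<And>n. vnorm A (t' n) \<le> B'" using norm_le_bound[OF c(2)] by blast
    have "(\<lambda>n. seminorm_dist (vmult A (s n) (t n)) (vmult A (s' n) (t' n))) \<longlonglongrightarrow> 0"
    proof (rule Lim_null_comparison)
      show "(\<lambda>n. B * seminorm_dist (t n) (t' n) + seminorm_dist (s n) (s' n) * B') \<longlonglongrightarrow> 0"
        using that unfolding null_rel_iff
        by (auto intro!: tendsto_add_zero tendsto_mult_right_zero tendsto_mult_left_zero)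
    qed (use c[THEN cauchy_seqs_carrier] cauchy_seqs_carrier[OF s] cauchy_seqs_carrier[OF t] B B' in
        \<open>auto intro!: always_eventually dist_mult_bound simp: dist_nonneg mult_closed\<close>)
    with s t c show ?thesis by (simp add: null_rel_iff mult_cauchy)
  qed
  from completion_op[where f = "\<lambda>s t n. vmult A (s n) (t n)", OF s t this] show ?thesis
    by (simp add: completion_def cls_def)
qed

text \<open>Equivalent sequences have the same limit of norms by the reverse triangle inequality, so
  the set given to \<open>the_elem\<close> is a singleton.\<close>

lemma completion_norm:
  assumes s: "s \<in> cauchy_seqs A"
  shows "(\<lambda>n. vnorm A (s n)) \<longlonglongrightarrow> vnorm (completion A) (cls s)"
proof -
  let ?L = "lim (\<lambda>n. vnorm A (s n))"
  have L: "(\<lambda>n. vnorm A (s n)) \<longlonglongrightarrow> ?L"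
    using norm_convergent[OF s] by (simp add: convergent_LIMSEQ_iff)
  have "lim (\<lambda>n. vnorm A (t n)) = ?L" if "t \<in> cls s" for t
  proof -
    have t: "(s, t) \<in> null_rel A" "t \<in> cauchy_seqs A"
      using that by (auto simp: mem_cls null_rel_iff)
    have "(\<lambda>n. vnorm A (s n) - vnorm A (t n)) \<longlonglongrightarrow> 0"
    proof (rule Lim_null_comparison)
      show "(\<lambda>n. seminorm_dist (s n) (t n)) \<longlonglongrightarrow> 0"
        using t by (simp add: null_rel_iff)
    qed (use cauchy_seqs_carrier[OF s] cauchy_seqs_carrier[OF t(2)] in
        \<open>auto intro!: always_eventually dist_norm\<close>)
    from tendsto_diff[OF L this] have "(\<lambda>n. vnorm A (t n)) \<longlonglongrightarrow> ?L" by simp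
    then show ?thesis by (rule limI)
  qed
  from image_cong[OF refl this]
  have "(\<lambda>t. lim (\<lambda>n. vnorm A (t n))) ` cls s = (\<lambda>t. ?L) ` cls s" .
  also have "\<dots> = {?L}"
    by (rule image_constant[OF self_mem_cls[OF s]])
  finally show ?thesis using L by (simp add: completion_def)
qed

section \<open>Coordinates on the completion\<close>

lemma coord_diff:
  assumes "u \<in> vcarrier A" "v \<in> vcarrier A"
  shows "c k (vdiff A u v) = c k u - c k v"
  using assms by (simp add: vdiff_def coord_add coord_scale scale_closed)

lemma coord_dist:
  assumes "u \<in> vcarrier A" "v \<in> vcarrier A"
  shows "cmod (c k u - c k v) \<le> seminorm_dist u v"
  using l2_le_cmod[OF coord_l2[OF vdiff_closed[OF assms]]]
  by (simp add: coord_diff assms seminorm_dist_def)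

definition completion_coord :: "'k \<Rightarrow> (nat \<Rightarrow> 'x \<Rightarrow> complex) set \<Rightarrow> complex" where
  "completion_coord k X = lim (\<lambda>n. c k ((SOME s. s \<in> X) n))"

text \<open>Each coordinate is 1-Lipschitz for \<open>seminorm_dist\<close>: it converges along
  Cauchy sequences, and equivalent sequences share the limit, so the representative chosen in the
  definition is immaterial.\<close>

lemma completion_coord:
  assumes s: "s \<in> cauchy_seqs A"
  shows "(\<lambda>n. c k (s n)) \<longlonglongrightarrow> completion_coord k (cls s)"
proof -
  define t where "t = (SOME t. t \<in> cls s)"
  have "t \<in> cls s"
    unfolding t_def by (rule someI[where P = "\<lambda>t. t \<in> cls s", OF self_mem_cls[OF s]])
  then have st: "(s, t) \<in> null_rel A" and t: "t \<in> cauchy_seqs A"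
    by (auto simp: mem_cls null_rel_iff)
  have "Cauchy (\<lambda>n. c k (t n))"
  proof (rule metric_CauchyI)
    fix \<epsilon> :: real assume "\<epsilon> > 0"
    then obtain N where N: "\<And>m n. m \<ge> N \<Longrightarrow> n \<ge> N \<Longrightarrow> seminorm_dist (t m) (t n) < \<epsilon>"
      using t unfolding cauchy_seqs_def seminorm_dist_def by blast
    show "\<exists>N. \<forall>m\<ge>N. \<forall>n\<ge>N. dist (c k (t m)) (c k (t n)) < \<epsilon>"
      unfolding Real_Vector_Spaces.dist_norm
      using N coord_dist[OF cauchy_seqs_carrier[OF t] cauchy_seqs_carrier[OF t]]
      by (meson le_less_trans)
  qed
  then have lim: "(\<lambda>n. c k (t n)) \<longlonglongrightarrow> completion_coord k (cls s)"
    unfolding completion_coord_def t_def[symmetric]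
    by (simp add: Cauchy_convergent_iff convergent_LIMSEQ_iff)
  have "(\<lambda>n. c k (s n) - c k (t n)) \<longlonglongrightarrow> 0"
  proof (rule Lim_null_comparison)
    show "(\<lambda>n. seminorm_dist (s n) (t n)) \<longlonglongrightarrow> 0"
      using st by (simp add: null_rel_iff)
  qed (use cauchy_seqs_carrier[OF s] cauchy_seqs_carrier[OF t] in
      \<open>auto intro!: always_eventually coord_dist\<close>)
  from tendsto_add[OF this lim] show ?thesis by simp
qed

lemma completion_coord_eqI:
  "s \<in> cauchy_seqs A \<Longrightarrow> (\<lambda>n. c k (s n)) \<longlonglongrightarrow> z \<Longrightarrow> completion_coord k (cls s) = z"
  by (rule LIMSEQ_unique[OF completion_coord])

lemma completion_coord_linear: "linear_form (completion A) (completion_coord k)"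
  unfolding linear_form_def completion_carrier
proof (intro conjI ballI allI; elim imageE; hypsubst)
  fix s t assume s: "s \<in> cauchy_seqs A" and t: "t \<in> cauchy_seqs A"
  have "(\<lambda>n. c k (vadd A (s n) (t n))) \<longlonglongrightarrow>
      completion_coord k (cls s) + completion_coord k (cls t)"
    using tendsto_add[OF completion_coord[OF s] completion_coord[OF t]]
    by (simp add: coord_add cauchy_seqs_carrier s t)
  then show "completion_coord k (vadd (completion A) (cls s) (cls t)) =
      completion_coord k (cls s) + completion_coord k (cls t)"
    unfolding completion_add[OF s t] by (rule completion_coord_eqI[OF add_cauchy[OF s t]])
next
  fix z s assume s: "s \<in> cauchy_seqs A"
  have "(\<lambda>n. c k (vscale A z (s n))) \<longlonglongrightarrow> z * completion_coord k (cls s)"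
    using tendsto_mult_left[OF completion_coord[OF s]]
    by (simp add: coord_scale cauchy_seqs_carrier s)
  then show "completion_coord k (vscale (completion A) z (cls s)) = z * completion_coord k (cls s)"
    unfolding completion_scale[OF s] by (rule completion_coord_eqI[OF scale_cauchy[OF s]])
qed

text \<open>Coordinates converge pointwise along a representative while the norms converge too, so
  lower semicontinuity preserves the bound.\<close>

lemma completion_coord_l2:
  assumes "X \<in> vcarrier (completion A)"
  shows "l2_le (\<lambda>k. completion_coord k X) (vnorm (completion A) X)"
proof -
  obtain s where s: "s \<in> cauchy_seqs A" "X = cls s"
    using assms by (auto simp: completion_carrier)
  show ?thesis
    unfolding s(2)
    by (rule l2_le_limit[OF _ completion_coord[OF s(1)] completion_norm[OF s(1)]])
      (auto intro: coord_l2 cauchy_seqs_carrier[OF s(1)])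
qed

abbreviation embed :: "('x \<Rightarrow> complex) \<Rightarrow> (nat \<Rightarrow> 'x \<Rightarrow> complex) set" where
  "embed u \<equiv> cls (\<lambda>_. u)"

lemma embed_norm: "u \<in> vcarrier A \<Longrightarrow> vnorm (completion A) (embed u) = vnorm A u"
  using completion_norm[OF const_cauchy, of u] by (simp add: LIMSEQ_const_iff)

lemma embed_coord: "u \<in> vcarrier A \<Longrightarrow> completion_coord k (embed u) = c k u"
  by (simp add: completion_coord_eqI const_cauchy)

lemma embed_carrier: "u \<in> vcarrier A \<Longrightarrow> embed u \<in> vcarrier (completion A)"
  by (simp add: completion_carrier const_cauchy)

lemma completion_diff:
  assumes "s \<in> cauchy_seqs A" "t \<in> cauchy_seqs A"
  shows "vdiff (completion A) (cls s) (cls t) = cls (\<lambda>n. vdiff A (s n) (t n))"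
  using assms by (simp add: vdiff_def completion_add completion_scale scale_cauchy)

lemma diff_cauchy:
  "s \<in> cauchy_seqs A \<Longrightarrow> t \<in> cauchy_seqs A \<Longrightarrow> (\<lambda>n. vdiff A (s n) (t n)) \<in> cauchy_seqs A"
  by (simp add: vdiff_def add_cauchy scale_cauchy)

text \<open>Density of the original algebra: the distance from \<open>embed (s n)\<close> to
  \<open>cls s\<close> is the limit over m of the distances from \<open>s n\<close> to
  \<open>s m\<close>.\<close>

lemma embed_tendsto:
  assumes s: "s \<in> cauchy_seqs A"
  shows "(\<lambda>n. vnorm (completion A) (vdiff (completion A) (embed (s n)) (cls s))) \<longlonglongrightarrow> 0"
proof (rule LIMSEQ_I)
  fix r :: real assume "r > 0"
  \<comment> \<open>Passing to the limit turns a strict bound into a weak one; half of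
    \<open>r\<close> leaves room to end strictly below \<open>r\<close>.\<close>
  then have "r / 2 > 0" by simp
  then obtain N where N: "\<And>m n. m \<ge> N \<Longrightarrow> n \<ge> N \<Longrightarrow> seminorm_dist (s m) (s n) < r / 2"
    using s unfolding cauchy_seqs_def seminorm_dist_def by blast
  have "norm (vnorm (completion A) (vdiff (completion A) (embed (s n)) (cls s)) - 0) < r"
    if "n \<ge> N" for n
  proof -
    note sc = cauchy_seqs_carrier[OF s]
    have lim: "(\<lambda>m. seminorm_dist (s n) (s m))
        \<longlonglongrightarrow> vnorm (completion A) (vdiff (completion A) (embed (s n)) (cls s))"
      unfolding completion_diff[OF const_cauchy[OF sc] s] seminorm_dist_def
      by (rule completion_norm[OF diff_cauchy[OF const_cauchy[OF sc] s]])
    have "vnorm (completion A) (vdiff (completion A) (embed (s n)) (cls s)) \<le> r / 2"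
      by (rule LIMSEQ_le_const2[OF lim]) (use N that less_imp_le in blast)
    moreover have "0 \<le> vnorm (completion A) (vdiff (completion A) (embed (s n)) (cls s))"
      by (rule LIMSEQ_le_const[OF lim]) (simp add: dist_nonneg sc)
    ultimately show ?thesis using \<open>r > 0\<close> by simp
  qed
  then show "\<exists>N. \<forall>n\<ge>N. norm (vnorm (completion A)
      (vdiff (completion A) (embed (s n)) (cls s)) - 0) < r"
    by blast
qed

text \<open>Both sides are continuous along representatives: the left through convergence of the
  coordinates in l2, the right through boundedness of \<open>\<omega>\<close> and density. The
  identity therefore extends from the original algebra.\<close>

lemma completion_mult_expansion:
  assumes lin: "linear_form (completion A) \<omega>"
    and bdd: "\<And>X. X \<in> vcarrier (completion A) \<Longrightarrow> cmod (\<omega> X) \<le> K * vnorm (completion A) X"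
    and X: "X \<in> vcarrier (completion A)" and Y: "Y \<in> vcarrier (completion A)"
  shows "((\<lambda>k. \<omega> (embed (E k)) * (completion_coord k X * completion_coord k Y))
    has_sum \<omega> (vmult (completion A) X Y)) UNIV"
proof -
  let ?D = "\<lambda>s n. vdiff (completion A) (embed (s n)) (cls s)"
  let ?w = "\<lambda>k. \<omega> (embed (E k))"
  obtain s where s: "s \<in> cauchy_seqs A" "X = cls s"
    using X by (auto simp: completion_carrier)
  obtain t where t: "t \<in> cauchy_seqs A" "Y = cls t"
    using Y by (auto simp: completion_carrier)
  \<comment> \<open>Applying \<open>completion_coord_l2\<close> to these differences yields
    convergence of the coordinates in the l2 norm, not merely pointwise.\<close>
  have D: "?D s n \<in> vcarrier (completion A)"
      "\<omega> (?D s n) = \<omega> (embed (s n)) - \<omega> (cls s)"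
      "completion_coord k (?D s n) = c k (s n) - completion_coord k (cls s)"
    if s: "s \<in> cauchy_seqs A" for s n k
  proof -
    note sc = cauchy_seqs_carrier[OF s]
    have "?D s n = vadd (completion A) (embed (s n)) (vscale (completion A) (-1) (cls s))"
      by (simp add: vdiff_def)
    moreover have car: "embed (s n) \<in> vcarrier (completion A)" "cls s \<in> vcarrier (completion A)"
      "vscale (completion A) (-1) (cls s) \<in> vcarrier (completion A)"
      using s by (auto simp: completion_carrier completion_scale scale_cauchy const_cauchy sc)
    ultimately show "\<omega> (?D s n) = \<omega> (embed (s n)) - \<omega> (cls s)"
      "completion_coord k (?D s n) = c k (s n) - completion_coord k (cls s)"
      using lin completion_coord_linear[of k] by (simp_all add: linear_form_def embed_coord sc)
    show "?D s n \<in> vcarrier (completion A)"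
      using s by (simp add: completion_diff const_cauchy sc completion_carrier diff_cauchy)
  qed
  have \<omega>_lim: "(\<lambda>n. \<omega> (embed (s n))) \<longlonglongrightarrow> \<omega> (cls s)" if s: "s \<in> cauchy_seqs A" for s
  proof (rule LIM_zero_cancel, rule Lim_null_comparison)
    show "(\<lambda>n. K * vnorm (completion A) (?D s n)) \<longlonglongrightarrow> 0"
      by (rule tendsto_mult_right_zero[OF embed_tendsto[OF s]])
    show "\<forall>\<^sub>F n in sequentially. cmod (\<omega> (embed (s n)) - \<omega> (cls s)) \<le> K * vnorm (completion A) (?D s n)"
      using bdd[OF D(1)[OF s]] D(2)[OF s] by simp
  qed
  have lin0: "linear_form A (\<lambda>u. \<omega> (embed u))"
    unfolding linear_form_def
  proof (intro conjI allI ballI)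
    fix u v z assume u: "u \<in> vcarrier A" and v: "v \<in> vcarrier A"
    show "\<omega> (embed (vadd A u v)) = \<omega> (embed u) + \<omega> (embed v)"
      using lin u v completion_add[OF const_cauchy[OF u] const_cauchy[OF v]]
      unfolding linear_form_def by (metis embed_carrier)
    show "\<omega> (embed (vscale A z u)) = z * \<omega> (embed u)"
      using lin u completion_scale[OF const_cauchy[OF u]]
      unfolding linear_form_def by (metis embed_carrier)
  qed
  have bdd0: "cmod (\<omega> (embed u)) \<le> K * vnorm A u" if "u \<in> vcarrier A" for u
    using bdd[OF embed_carrier[OF that]] that by (simp add: embed_norm)
  have w: "cmod (?w k) \<le> \<bar>K\<bar>" for k
    by (rule bounded_on_units[OF bdd0])
  have "\<omega> (embed (vmult A (s n) (t n))) = (\<Sum>\<^sub>\<infinity>k. (?w k * c k (s n)) * c k (t n))" for n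
    using infsumI[OF mult_expansion[OF lin0 bdd0 cauchy_seqs_carrier[OF s(1)] cauchy_seqs_carrier[OF t(1)]]]
    by (simp add: mult.assoc)
  \<comment> \<open>The bounded weights are absorbed into the first family, which leaves a
    continuous pairing of two l2 families.\<close>
  moreover have "(\<lambda>n. \<Sum>\<^sub>\<infinity>k. (?w k * c k (s n)) * c k (t n)) \<longlonglongrightarrow>
      (\<Sum>\<^sub>\<infinity>k. (?w k * completion_coord k X) * completion_coord k Y)"
  proof (rule l2_le_mult_infsum_tendsto)
    show "l2_le (\<lambda>k. ?w k * c k (s n) - ?w k * completion_coord k X)
        (\<bar>K\<bar> * vnorm (completion A) (?D s n))" for n
      using l2_le_bounded_mult[OF completion_coord_l2[OF D(1)[OF s(1)]], of ?w, OF w, of n]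
      by (simp add: D(3)[OF s(1)] s(2) right_diff_distrib)
    show "l2_le (\<lambda>k. c k (t n) - completion_coord k Y) (vnorm (completion A) (?D t n))" for n
      using completion_coord_l2[OF D(1)[OF t(1)], of n] by (simp add: D(3)[OF t(1)] t(2))
    show "l2_le (\<lambda>k. ?w k * completion_coord k X) (\<bar>K\<bar> * vnorm (completion A) X)"
      by (intro l2_le_bounded_mult completion_coord_l2 X w)
    show "l2_le (\<lambda>k. completion_coord k Y) (vnorm (completion A) Y)"
      by (rule completion_coord_l2[OF Y])
  qed (intro tendsto_mult_right_zero embed_tendsto s t)+
  moreover have "(\<lambda>n. \<omega> (embed (vmult A (s n) (t n)))) \<longlonglongrightarrow> \<omega> (vmult (completion A) X Y)"
    using \<omega>_lim[OF mult_cauchy[OF s(1) t(1)]] by (simp add: s(2) t(2) completion_mult[OF s(1) t(1)])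
  ultimately have "\<omega> (vmult (completion A) X Y) =
      (\<Sum>\<^sub>\<infinity>k. (?w k * completion_coord k X) * completion_coord k Y)"
    by (simp add: LIMSEQ_unique)
  moreover have "(\<lambda>k. (?w k * completion_coord k X) * completion_coord k Y) summable_on UNIV"
    by (rule l2_le_mult_summable[OF l2_le_bounded_mult[OF completion_coord_l2[OF X] w]
          completion_coord_l2[OF Y]])
  ultimately show ?thesis
    by (simp add: has_sum_infsum mult.assoc)
qed

theorem completion_coordinates:
  "coordinates (completion A) completion_coord (\<lambda>k. embed (E k))"
proof (unfold_locales, goal_cases)
  case (1 X Y)
  then show ?case by (auto simp: completion_carrier completion_add add_cauchy)
next
  case (2 X z)
  then show ?case by (auto simp: completion_carrier completion_scale scale_cauchy)
next
  case 3
  show ?case by (rule completion_coord_linear)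
next
  case (4 X)
  then show ?case by (rule completion_coord_l2)
next
  case 5
  show ?case by (rule embed_carrier[OF unit_carrier])
next
  case 6
  show ?case by (simp add: embed_norm unit_carrier unit_norm)
next
  case (7 \<omega> K X Y)
  then show ?case by (rule completion_mult_expansion)
qed

end

section \<open>Projective tensor products\<close>

lemma sum_lessThan_add: "(\<Sum>i<m + n. f i) = (\<Sum>i<m. f i) + (\<Sum>i<n. f (m + i))"
  for f :: "nat \<Rightarrow> 'a::comm_monoid_add"
  by (induction n) (simp_all add: add.assoc)

lemma has_sum_sum:
  fixes f :: "'i \<Rightarrow> 'k \<Rightarrow> 'a::topological_comm_monoid_add"
  assumes "\<And>i. i \<in> I \<Longrightarrow> (f i has_sum s i) S"
  shows "((\<lambda>k. \<Sum>i\<in>I. f i k) has_sum (\<Sum>i\<in>I. s i)) S"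
  using assms
  by (induction I rule: infinite_finite_induct) (auto intro: has_sum_add)

locale tensor_of_coordinate_algebras =
  A: coordinate_algebra A c E + B: coordinate_algebra B d G
  for A :: "('a, 'm) calgebra_scheme" and c :: "'j \<Rightarrow> 'a \<Rightarrow> complex" and E :: "'j \<Rightarrow> 'a"
    and B :: "('b, 'n) calgebra_scheme" and d :: "'k \<Rightarrow> 'b \<Rightarrow> complex" and G :: "'k \<Rightarrow> 'b"
begin

abbreviation T where "T \<equiv> algebraic_tensor A B"
abbreviation el where "el \<equiv> elementary_tensor A B"
abbreviation rep where "rep \<equiv> tensor_representation A B"

definition cost :: "nat \<Rightarrow> (nat \<Rightarrow> 'a) \<Rightarrow> (nat \<Rightarrow> 'b) \<Rightarrow> real" where
  "cost n x y = (\<Sum>i<n. vnorm A (x i) * vnorm B (y i))"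

lemma carrier_iff: "u \<in> vcarrier T \<longleftrightarrow> (\<exists>n x y. rep u n x y)"
  by (simp add: algebraic_tensor_def)

lemma rep_closed:
  assumes "rep u n x y" "i < n"
  shows "x i \<in> vcarrier A" "y i \<in> vcarrier B"
  using assms by (auto simp: tensor_representation_def)

lemma rep_eq: "rep u n x y \<Longrightarrow> u = (\<lambda>\<beta>. \<Sum>i<n. el (x i) (y i) \<beta>)"
  by (simp add: tensor_representation_def)

lemma vadd_T: "vadd T u v = (\<lambda>\<beta>. u \<beta> + v \<beta>)"
  and vscale_T: "vscale T z u = (\<lambda>\<beta>. z * u \<beta>)"
  and vmult_T: "vmult T = tensor_mult A B"
  and vnorm_T: "vnorm T = projective_norm A B"
  by (simp_all add: algebraic_tensor_def)

lemma el_add_left: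
  "\<lbrakk>x \<in> vcarrier A; x' \<in> vcarrier A; y \<in> vcarrier B\<rbrakk>
    \<Longrightarrow> el (vadd A x x') y = vadd T (el x y) (el x' y)"
  by (auto simp: elementary_tensor_def vadd_T bilinear_forms_def linear_form_def)

lemma el_add_right:
  "\<lbrakk>x \<in> vcarrier A; y \<in> vcarrier B; y' \<in> vcarrier B\<rbrakk>
    \<Longrightarrow> el x (vadd B y y') = vadd T (el x y) (el x y')"
  by (auto simp: elementary_tensor_def vadd_T bilinear_forms_def linear_form_def)

lemma el_scale_left:
  "x \<in> vcarrier A \<Longrightarrow> y \<in> vcarrier B \<Longrightarrow> el (vscale A z x) y = vscale T z (el x y)"
  by (auto simp: elementary_tensor_def vscale_T bilinear_forms_def linear_form_def)

lemma el_scale_right: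
  "x \<in> vcarrier A \<Longrightarrow> y \<in> vcarrier B \<Longrightarrow> el x (vscale B z y) = vscale T z (el x y)"
  by (auto simp: elementary_tensor_def vscale_T bilinear_forms_def linear_form_def)

lemma rep_el: "x \<in> vcarrier A \<Longrightarrow> y \<in> vcarrier B \<Longrightarrow> rep (el x y) 1 (\<lambda>_. x) (\<lambda>_. y)"
  by (simp add: tensor_representation_def)

lemma el_carrier: "x \<in> vcarrier A \<Longrightarrow> y \<in> vcarrier B \<Longrightarrow> el x y \<in> vcarrier T"
  unfolding carrier_iff using rep_el by blast

lemma rep_add:
  assumes u: "rep u m x y" and v: "rep v n z w"
  shows "rep (vadd T u v) (m + n) (\<lambda>i. if i < m then x i else z (i - m))
    (\<lambda>i. if i < m then y i else w (i - m))"
  using assms by (auto simp: tensor_representation_def vadd_T sum_lessThan_add)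

lemma cost_add:
  "cost (m + n) (\<lambda>i. if i < m then x i else z (i - m)) (\<lambda>i. if i < m then y i else w (i - m)) =
    cost m x y + cost n z w"
  by (simp add: cost_def sum_lessThan_add)

lemma rep_scale:
  assumes "rep u n x y"
  shows "rep (vscale T z u) n (\<lambda>i. vscale A z (x i)) y"
  using assms
  by (auto simp: tensor_representation_def A.scale_closed el_scale_left vscale_T sum_distrib_left)

lemma cost_scale:
  assumes "rep u n x y"
  shows "cost n (\<lambda>i. vscale A z (x i)) y \<le> cmod z * cost n x y"
proof -
  have "cost n (\<lambda>i. vscale A z (x i)) y \<le> (\<Sum>i<n. (cmod z * vnorm A (x i)) * vnorm B (y i))"
    unfolding cost_def using rep_closed[OF assms]
    by (intro sum_mono mult_right_mono A.norm_scale B.norm_nonneg) auto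
  then show ?thesis by (simp add: cost_def sum_distrib_left mult.assoc)
qed

lemma add_carrier: "u \<in> vcarrier T \<Longrightarrow> v \<in> vcarrier T \<Longrightarrow> vadd T u v \<in> vcarrier T"
  unfolding carrier_iff using rep_add by blast

lemma scale_carrier: "u \<in> vcarrier T \<Longrightarrow> vscale T z u \<in> vcarrier T"
  unfolding carrier_iff using rep_scale by blast

lemma zero_carrier: "(\<lambda>_. 0) \<in> vcarrier T"
proof -
  have "rep (\<lambda>_. 0) 0 undefined undefined"
    by (simp add: tensor_representation_def)
  then show ?thesis
    unfolding carrier_iff by blast
qed

lemma sum_carrier:
  assumes "finite I" "\<And>i. i \<in> I \<Longrightarrow> f i \<in> vcarrier T"
  shows "(\<lambda>\<beta>. \<Sum>i\<in>I. f i \<beta>) \<in> vcarrier T"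
  using assms
proof (induction I)
  case (insert i I)
  with add_carrier[of "f i" "\<lambda>\<beta>. \<Sum>i\<in>I. f i \<beta>"] show ?case by (simp add: vadd_T)
qed (simp add: zero_carrier)

lemma linear_form_sum:
  assumes \<omega>: "linear_form T \<omega>" and I: "finite I" "\<And>i. i \<in> I \<Longrightarrow> f i \<in> vcarrier T"
  shows "\<omega> (\<lambda>\<beta>. \<Sum>i\<in>I. f i \<beta>) = (\<Sum>i\<in>I. \<omega> (f i))"
  using I
proof (induction I)
  case empty
  have "\<omega> (vscale T 0 (\<lambda>_. 0)) = 0 * \<omega> (\<lambda>_. 0)"
    using \<omega> zero_carrier unfolding linear_form_def by blast
  then show ?case by (simp add: vscale_T)
next
  case (insert i I)
  have "\<omega> (vadd T (f i) (\<lambda>\<beta>. \<Sum>i\<in>I. f i \<beta>)) = \<omega> (f i) + \<omega> (\<lambda>\<beta>. \<Sum>i\<in>I. f i \<beta>)"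
    using \<omega> insert sum_carrier[of I f] unfolding linear_form_def by blast
  with insert show ?case by (simp add: vadd_T)
qed

lemma cost_nonneg: "rep u n x y \<Longrightarrow> 0 \<le> cost n x y"
  unfolding cost_def
  by (intro sum_nonneg mult_nonneg_nonneg A.norm_nonneg B.norm_nonneg) (auto dest: rep_closed)

lemma projective_norm_le:
  assumes "rep u n x y"
  shows "projective_norm A B u \<le> cost n x y"
  unfolding projective_norm_def
proof (rule cInf_lower)
  show "bdd_below {(\<Sum>i<n. vnorm A (x i) * vnorm B (y i)) |n x y. rep u n x y}"
    by (rule bdd_belowI[of _ 0]) (auto dest: cost_nonneg simp: cost_def)
qed (use assms in \<open>auto simp: cost_def\<close>)

text \<open>The factor \<open>r\<close> allows an infimum over representations of one tensor while a
  cost or norm of the other is held fixed. For \<open>r = 0\<close> a single representation already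
  gives the claim; otherwise one divides by \<open>r\<close>.\<close>

lemma le_mult_projective_norm:
  assumes u: "u \<in> vcarrier T" and "0 \<le> r" and le: "\<And>n x y. rep u n x y \<Longrightarrow> t \<le> r * cost n x y"
  shows "t \<le> r * projective_norm A B u"
proof (cases "r = 0")
  case True
  with u le show ?thesis by (auto simp: carrier_iff)
next
  case False
  with \<open>0 \<le> r\<close> have "0 < r" by simp
  have "t / r \<le> projective_norm A B u"
    unfolding projective_norm_def
  proof (rule cInf_greatest)
    show "{(\<Sum>i<n. vnorm A (x i) * vnorm B (y i)) |n x y. rep u n x y} \<noteq> {}"
      using u by (auto simp: carrier_iff)
  qed (use le \<open>0 < r\<close> in \<open>auto simp: cost_def pos_divide_le_eq mult.commute\<close>)
  with \<open>0 < r\<close> show ?thesis by (simp add: pos_divide_le_eq mult.commute)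
qed

text \<open>Concatenating representations adds costs; the infimum over representations of
  \<open>v\<close> is taken with one of \<open>u\<close> fixed, and then over those of
  \<open>u\<close>.\<close>

lemma norm_triangle:
  assumes u: "u \<in> vcarrier T" and v: "v \<in> vcarrier T"
  shows "vnorm T (vadd T u v) \<le> vnorm T u + vnorm T v"
proof -
  let ?p = "projective_norm A B"
  have "?p (vadd T u v) - ?p v \<le> 1 * cost m x y" if x: "rep u m x y" for m x y
  proof -
    have "?p (vadd T u v) - cost m x y \<le> 1 * ?p v"
      using v
    proof (rule le_mult_projective_norm)
      fix n z w assume "rep v n z w"
      from projective_norm_le[OF rep_add[OF x this]]
      show "?p (vadd T u v) - cost m x y \<le> 1 * cost n z w"
        by (simp add: cost_add)
    qed simp
    then show ?thesis by simp
  qed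
  from le_mult_projective_norm[OF u _ this] show ?thesis by (simp add: vnorm_T)
qed

lemma norm_scale:
  assumes "u \<in> vcarrier T"
  shows "vnorm T (vscale T z u) \<le> cmod z * vnorm T u"
  unfolding vnorm_T using assms
proof (rule le_mult_projective_norm)
  fix n x y assume "rep u n x y"
  from projective_norm_le[OF rep_scale[OF this]] cost_scale[OF this]
  show "projective_norm A B (vscale T z u) \<le> cmod z * cost n x y"
    by (rule order_trans)
qed simp

lemma norm_el:
  assumes "x \<in> vcarrier A" "y \<in> vcarrier B"
  shows "vnorm T (el x y) \<le> vnorm A x * vnorm B y"
  using projective_norm_le[OF rep_el[OF assms]] by (simp add: vnorm_T cost_def)

lemma norm_sum:
  assumes "finite I" "\<And>i. i \<in> I \<Longrightarrow> f i \<in> vcarrier T"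
  shows "vnorm T (\<lambda>\<beta>. \<Sum>i\<in>I. f i \<beta>) \<le> (\<Sum>i\<in>I. vnorm T (f i))"
  using assms
proof (induction I)
  case empty
  show ?case using norm_scale[OF zero_carrier, of 0] by (simp add: vscale_T)
next
  case (insert i I)
  with norm_triangle[of "f i" "\<lambda>\<beta>. \<Sum>i\<in>I. f i \<beta>"] sum_carrier[of I f] show ?case
    by (simp add: vadd_T)
qed

lemma mult_rep:
  assumes "rep u m x y" "rep v n z w"
  shows "vmult T u v =
    (\<lambda>\<beta>. \<Sum>i<m. \<Sum>j<n. el (vmult A (x i) (z j)) (vmult B (y i) (w j)) \<beta>)"
  unfolding vmult_T using A.bilinear B.bilinear assms by (rule tensor_mult_representation)

lemma mult_el_carrier:
  assumes "rep u m x y" "rep v n z w" "i < m" "j < n"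
  shows "el (vmult A (x i) (z j)) (vmult B (y i) (w j)) \<in> vcarrier T"
  using assms by (intro el_carrier A.mult_closed B.mult_closed rep_closed)

lemma mult_carrier:
  assumes "u \<in> vcarrier T" "v \<in> vcarrier T"
  shows "vmult T u v \<in> vcarrier T"
proof -
  obtain m x y n z w where r: "rep u m x y" "rep v n z w"
    using assms by (auto simp: carrier_iff)
  show ?thesis
    unfolding mult_rep[OF r]
    by (intro sum_carrier[of "{..<m}"] sum_carrier[of "{..<n}"] mult_el_carrier[OF r]) auto
qed

text \<open>Multiplying representations termwise gives a double sum whose cost is at most the
  product of the two costs; the infima are again taken one at a time.\<close>

lemma norm_mult:
  assumes u: "u \<in> vcarrier T" and v: "v \<in> vcarrier T"
  shows "vnorm T (vmult T u v) \<le> vnorm T u * vnorm T v"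
proof -
  let ?p = "projective_norm A B"
  have prod: "?p (vmult T u v) \<le> cost m x y * cost n z w" if r: "rep u m x y" "rep v n z w" for m x y n z w
  proof -
    have "?p (vmult T u v) \<le>
        (\<Sum>i<m. vnorm T (\<lambda>\<beta>. \<Sum>j<n. el (vmult A (x i) (z j)) (vmult B (y i) (w j)) \<beta>))"
      unfolding mult_rep[OF r] vnorm_T[symmetric]
      by (intro norm_sum sum_carrier mult_el_carrier[OF r]) auto
    also have "\<dots> \<le> (\<Sum>i<m. \<Sum>j<n. vnorm T (el (vmult A (x i) (z j)) (vmult B (y i) (w j))))"
      by (intro sum_mono norm_sum mult_el_carrier[OF r]) auto
    also have "\<dots> \<le> (\<Sum>i<m. \<Sum>j<n. (vnorm A (x i) * vnorm B (y i)) * (vnorm A (z j) * vnorm B (w j)))"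
    proof (intro sum_mono)
      fix i j assume "i \<in> {..<m}" "j \<in> {..<n}"
      then have car: "x i \<in> vcarrier A" "y i \<in> vcarrier B" "z j \<in> vcarrier A" "w j \<in> vcarrier B"
        using r by (auto dest: rep_closed)
      have "vnorm T (el (vmult A (x i) (z j)) (vmult B (y i) (w j))) \<le>
          vnorm A (vmult A (x i) (z j)) * vnorm B (vmult B (y i) (w j))"
        using car by (intro norm_el A.mult_closed B.mult_closed)
      also have "\<dots> \<le> (vnorm A (x i) * vnorm A (z j)) * (vnorm B (y i) * vnorm B (w j))"
        using car by (intro mult_mono A.norm_mult B.norm_mult mult_nonneg_nonneg
            A.norm_nonneg B.norm_nonneg B.mult_closed)
      finally show "vnorm T (el (vmult A (x i) (z j)) (vmult B (y i) (w j))) \<le>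
          (vnorm A (x i) * vnorm B (y i)) * (vnorm A (z j) * vnorm B (w j))"
        by (simp add: mult_ac)
    qed
    also have "\<dots> = cost m x y * cost n z w"
      by (simp add: cost_def sum_product)
    finally show ?thesis .
  qed
  have "?p (vmult T u v) \<le> ?p v * cost m x y" if r: "rep u m x y" for m x y
    using le_mult_projective_norm[OF v cost_nonneg[OF r] prod[OF r]] by (simp add: mult.commute)
  moreover have "0 \<le> ?p v"
    using le_mult_projective_norm[OF v, of 1 0] by (simp add: cost_nonneg)
  ultimately show ?thesis
    using le_mult_projective_norm[OF u, of "?p v"] by (simp add: vnorm_T mult.commute)
qed

lemma bilinear_mult_tensor: "bilinear_mult T"
  unfolding bilinear_mult_def
proof (intro ballI conjI allI)
  fix u v assume u: "u \<in> vcarrier T" and v: "v \<in> vcarrier T"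
  show "vadd T u v \<in> vcarrier T" "vmult T u v \<in> vcarrier T"
    using u v by (rule add_carrier mult_carrier)+
  obtain m x y n z w where ru: "rep u m x y" and rv: "rep v n z w"
    using u v by (auto simp: carrier_iff)
  \<comment> \<open>In \<open>tensor_mult\<close> the left factor is evaluated outermost, so
    additivity in it is pointwise. The right factor sits inside the form handed to the left one, and
    additivity there goes through representations.\<close>
  show "vmult T (vadd T u v) t = vadd T (vmult T u t) (vmult T v t)" for t
    by (simp add: vmult_T vadd_T tensor_mult_def fun_eq_iff)
  show "vmult T t (vadd T u v) = vadd T (vmult T t u) (vmult T t v)" if t: "t \<in> vcarrier T" for t
  proof -
    obtain k r s where rt: "rep t k r s" using t by (auto simp: carrier_iff)
    show ?thesis
      unfolding mult_rep[OF rt rep_add[OF ru rv]] mult_rep[OF rt ru] mult_rep[OF rt rv]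
      by (simp add: vadd_T sum_lessThan_add sum.distrib)
  qed
  fix a
  show "vscale T a u \<in> vcarrier T"
    using u by (rule scale_carrier)
  show "vmult T (vscale T a u) v = vscale T a (vmult T u v)"
    by (simp add: vmult_T vscale_T tensor_mult_def fun_eq_iff)
  show "vmult T u (vscale T a v) = vscale T a (vmult T u v)"
    unfolding mult_rep[OF ru rep_scale[OF rv]] mult_rep[OF ru rv]
    using rep_closed[OF ru] rep_closed[OF rv]
    by (simp add: A.mult_scale_right el_scale_left A.mult_closed B.mult_closed)
       (simp add: vscale_T sum_distrib_left)
qed

section \<open>Coordinates on the algebraic tensor product\<close>

definition tensor_coord :: "'j \<times> 'k \<Rightarrow> (('a \<Rightarrow> 'b \<Rightarrow> complex) \<Rightarrow> complex) \<Rightarrow> complex" where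
  "tensor_coord p u = u (\<lambda>x y. c (fst p) x * d (snd p) y)"

definition tensor_unit :: "'j \<times> 'k \<Rightarrow> ('a \<Rightarrow> 'b \<Rightarrow> complex) \<Rightarrow> complex" where
  "tensor_unit p = el (E (fst p)) (G (snd p))"

text \<open>Ensures that elementary tensors evaluate this form genuinely instead of returning their
  default value 0.\<close>

lemma coord_bilinear: "(\<lambda>x y. c j x * d k y) \<in> bilinear_forms A B"
  by (simp add: bilinear_forms_def linear_form_def A.coord_add B.coord_add A.coord_scale
      B.coord_scale algebra_simps)

lemma tensor_coord_rep:
  assumes "rep u n x y"
  shows "tensor_coord p u = (\<Sum>i<n. c (fst p) (x i) * d (snd p) (y i))"
  using coord_bilinear by (simp add: rep_eq[OF assms] tensor_coord_def elementary_tensor_def)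

text \<open>The projective norm dominates the Hilbert tensor norm: the coordinates of an elementary
  tensor have l2 norm at most the product of the norms of its factors, and the triangle inequality
  covers sums.\<close>

lemma tensor_coord_l2:
  assumes u: "u \<in> vcarrier T"
  shows "l2_le (\<lambda>p. tensor_coord p u) (vnorm T u)"
proof (rule l2_leI)
  fix F
  have "L2_set (\<lambda>p. cmod (tensor_coord p u)) F \<le> 1 * projective_norm A B u"
    using u
  proof (rule le_mult_projective_norm)
    fix n x y assume r: "rep u n x y"
    have "l2_le (\<lambda>p. \<Sum>i<n. c (fst p) (x i) * d (snd p) (y i)) (cost n x y)"
      unfolding cost_def
    proof (rule l2_le_sum)
      fix i assume "i \<in> {..<n}"
      then have "x i \<in> vcarrier A" "y i \<in> vcarrier B"
        using rep_closed[OF r] by auto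
      from l2_le_prod[OF A.coord_l2[OF this(1)] B.coord_l2[OF this(2)]]
      show "l2_le (\<lambda>p. c (fst p) (x i) * d (snd p) (y i)) (vnorm A (x i) * vnorm B (y i))"
        by (simp add: case_prod_unfold)
    qed simp
    then show "L2_set (\<lambda>p. cmod (tensor_coord p u)) F \<le> 1 * cost n x y"
      by (simp add: tensor_coord_rep[OF r] l2_leD)
  qed simp
  then show "L2_set (\<lambda>p. cmod (tensor_coord p u)) F \<le> vnorm T u"
    by (simp add: vnorm_T)
qed

lemma tensor_unit_carrier: "tensor_unit p \<in> vcarrier T"
  unfolding tensor_unit_def by (intro el_carrier A.unit_carrier B.unit_carrier)

lemma tensor_unit_norm: "vnorm T (tensor_unit p) \<le> 1"
proof -
  have "vnorm T (tensor_unit p) \<le> vnorm A (E (fst p)) * vnorm B (G (snd p))"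
    unfolding tensor_unit_def by (intro norm_el A.unit_carrier B.unit_carrier)
  also have "\<dots> \<le> 1 * 1"
    by (intro mult_mono A.unit_norm B.unit_norm B.norm_nonneg B.unit_carrier) simp
  finally show ?thesis by simp
qed

lemma norm_T_nonneg: "u \<in> vcarrier T \<Longrightarrow> 0 \<le> vnorm T u"
  by (rule l2_le_nonneg[OF tensor_coord_l2])

text \<open>Expanding one component with the other held fixed gives an iterated sum; summability
  over pairs of indices converts it into a joint one.\<close>

lemma el_mult_expansion:
  assumes lin: "linear_form T \<omega>"
    and bdd: "\<And>u. u \<in> vcarrier T \<Longrightarrow> cmod (\<omega> u) \<le> K * vnorm T u"
    and x: "x \<in> vcarrier A" and z: "z \<in> vcarrier A" and y: "y \<in> vcarrier B" and w: "w \<in> vcarrier B"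
  shows "((\<lambda>p. \<omega> (tensor_unit p) * ((c (fst p) x * d (snd p) y) * (c (fst p) z * d (snd p) w)))
    has_sum \<omega> (el (vmult A x z) (vmult B y w))) UNIV"
proof -
  have el_bound: "cmod (\<omega> (el a b)) \<le> \<bar>K\<bar> * (vnorm A a * vnorm B b)"
    if "a \<in> vcarrier A" "b \<in> vcarrier B" for a b
  proof -
    have "cmod (\<omega> (el a b)) \<le> K * vnorm T (el a b)"
      by (intro bdd el_carrier that)
    also have "\<dots> \<le> \<bar>K\<bar> * (vnorm A a * vnorm B b)"
      by (intro mult_mono norm_el that norm_T_nonneg el_carrier) auto
    finally show ?thesis .
  qed
  have yw: "vmult B y w \<in> vcarrier B"
    using y w by (rule B.mult_closed)
  \<comment> \<open>Here the second component stays frozen at the whole product;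
    \<open>right\<close> then expands it with a unit in the first component.\<close>
  have left: "((\<lambda>j. \<omega> (el (E j) (vmult B y w)) * (c j x * c j z))
      has_sum \<omega> (el (vmult A x z) (vmult B y w))) UNIV"
  proof (rule A.mult_expansion)
    show "linear_form A (\<lambda>a. \<omega> (el a (vmult B y w)))"
      using lin yw unfolding linear_form_def by (auto simp: el_add_left el_scale_left el_carrier)
    show "cmod (\<omega> (el a (vmult B y w))) \<le> (\<bar>K\<bar> * vnorm B (vmult B y w)) * vnorm A a"
      if "a \<in> vcarrier A" for a
      using el_bound[OF that yw] by (simp add: mult_ac)
  qed fact+
  have right: "((\<lambda>k. \<omega> (el (E j) (G k)) * (d k y * d k w)) has_sum \<omega> (el (E j) (vmult B y w))) UNIV"
    for j
  proof (rule B.mult_expansion)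
    show "linear_form B (\<lambda>b. \<omega> (el (E j) b))"
      using lin A.unit_carrier[of j] unfolding linear_form_def
      by (auto simp: el_add_right el_scale_right el_carrier)
    show "cmod (\<omega> (el (E j) b)) \<le> (\<bar>K\<bar> * vnorm A (E j)) * vnorm B b"
      if "b \<in> vcarrier B" for b
      using el_bound[OF A.unit_carrier that] by (simp add: mult_ac)
  qed fact+
  let ?f = "\<lambda>(j, k). (\<omega> (el (E j) (G k)) * (c j x * d k y)) * (c j z * d k w)"
  have unit: "cmod (\<omega> (case p of (j, k) \<Rightarrow> el (E j) (G k))) \<le> \<bar>K\<bar>" for p
  proof -
    have "cmod (\<omega> (tensor_unit p)) \<le> K * vnorm T (tensor_unit p)"
      by (intro bdd tensor_unit_carrier)
    also have "\<dots> \<le> \<bar>K\<bar> * 1"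
      by (intro mult_mono tensor_unit_norm norm_T_nonneg tensor_unit_carrier) auto
    finally show ?thesis by (simp add: tensor_unit_def case_prod_unfold)
  qed
  \<comment> \<open>Grouping the coordinates by the pairs x, y and z, w gives two l2 families over
    index pairs, so Cauchy-Schwarz with bounded weights applies. This summability justifies merging
    the iterated sums.\<close>
  have "?f summable_on UNIV"
    using l2_le_mult_summable[OF l2_le_bounded_mult[OF l2_le_prod[OF A.coord_l2[OF x] B.coord_l2[OF y]] unit]
        l2_le_prod[OF A.coord_l2[OF z] B.coord_l2[OF w]]]
    by (simp add: case_prod_unfold)
  then have "(?f has_sum \<omega> (el (vmult A x z) (vmult B y w))) (UNIV \<times> UNIV)"
  proof (intro has_sum_SigmaI[OF _ left])
    fix j
    show "((\<lambda>k. ?f (j, k)) has_sum \<omega> (el (E j) (vmult B y w)) * (c j x * c j z)) UNIV"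
      using has_sum_cmult_left[OF right[of j], of "c j x * c j z"] by (simp add: mult_ac)
  qed simp
  then show ?thesis
    by (simp add: case_prod_unfold tensor_unit_def mult_ac)
qed

lemma tensor_mult_expansion:
  assumes lin: "linear_form T \<omega>"
    and bdd: "\<And>u. u \<in> vcarrier T \<Longrightarrow> cmod (\<omega> u) \<le> K * vnorm T u"
    and u: "u \<in> vcarrier T" and v: "v \<in> vcarrier T"
  shows "((\<lambda>p. \<omega> (tensor_unit p) * (tensor_coord p u * tensor_coord p v))
    has_sum \<omega> (vmult T u v)) UNIV"
proof -
  obtain m x y n z w where r: "rep u m x y" "rep v n z w"
    using u v by (auto simp: carrier_iff)
  have "\<omega> (vmult T u v) = (\<Sum>i<m. \<omega> (\<lambda>\<beta>. \<Sum>j<n. el (vmult A (x i) (z j)) (vmult B (y i) (w j)) \<beta>))"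
    unfolding mult_rep[OF r]
    by (intro linear_form_sum[OF lin] sum_carrier mult_el_carrier[OF r]) auto
  also have "\<dots> = (\<Sum>i<m. \<Sum>j<n. \<omega> (el (vmult A (x i) (z j)) (vmult B (y i) (w j))))"
    by (intro sum.cong refl linear_form_sum[OF lin] mult_el_carrier[OF r]) auto
  finally have "\<omega> (vmult T u v) =
      (\<Sum>i<m. \<Sum>j<n. \<omega> (el (vmult A (x i) (z j)) (vmult B (y i) (w j))))" .
  moreover have "((\<lambda>p. \<Sum>i<m. \<Sum>j<n. \<omega> (tensor_unit p) *
      ((c (fst p) (x i) * d (snd p) (y i)) * (c (fst p) (z j) * d (snd p) (w j))))
      has_sum (\<Sum>i<m. \<Sum>j<n. \<omega> (el (vmult A (x i) (z j)) (vmult B (y i) (w j))))) UNIV"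
    by (intro has_sum_sum el_mult_expansion[OF lin bdd]) (auto dest: rep_closed[OF r(1)] rep_closed[OF r(2)])
  ultimately show ?thesis
    unfolding tensor_coord_rep[OF r(1)] tensor_coord_rep[OF r(2)] sum_product
    by (simp only: sum_distrib_left)
qed

theorem tensor_coordinate_function_algebra:
  "coordinate_function_algebra T tensor_coord tensor_unit"
proof (unfold_locales, goal_cases)
  case (3 p)
  show ?case by (simp add: linear_form_def tensor_coord_def vadd_T vscale_T)
next
  case (7 \<omega> K u v)
  then show ?case by (rule tensor_mult_expansion)
next
  case (11 u v)
  show ?case by (rule vadd_T)
next
  case (12 z u)
  show ?case by (rule vscale_T)
qed (simp_all add: add_carrier scale_carrier tensor_coord_l2 tensor_unit_carrier tensor_unit_norm
    bilinear_mult_tensor norm_scale norm_mult norm_triangle)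

end

section \<open>Hilbert--Schmidt operators\<close>

instance chilbert_space \<subseteq> banach ..

lemma scaleC_one [simp]: "1 *\<^sub>C x = x"
  using scaleC_of_real[of 1 x] by simp

lemma module_scaleC: "module (scaleC :: complex \<Rightarrow> 'h::chilbert_space \<Rightarrow> 'h)"
  by unfold_locales (simp_all add: scaleC_add_right scaleC_add_left scaleC_scaleC)

lemma cinner_scaleC_right: "cinner x (c *\<^sub>C y) = cnj c * cinner x y"
  by (metis cinner_scaleC_left cinner_commute complex_cnj_mult)

lemma cinner_minus_left: "cinner (- x) y = - cinner x y"
  using cinner_scaleC_left[of "-1" x y] scaleC_of_real[of "-1" x] by simp

lemma cinner_diff_left: "cinner (x - y) z = cinner x z - cinner y z"
  using cinner_add_left[of x "-y" z] by (simp add: cinner_minus_left)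

lemma cinner_self: "cinner x x = complex_of_real ((norm x)\<^sup>2)"
proof (rule complex_eqI)
  show "Re (cinner x x) = Re (complex_of_real ((norm x)\<^sup>2))"
    by (simp add: Re_cinner power2_norm_eq_inner)
  have "Im (cinner x x) = Im (cnj (cinner x x))"
    by (subst cinner_commute) (rule refl)
  then show "Im (cinner x x) = Im (complex_of_real ((norm x)\<^sup>2))"
    by (simp del: of_real_power)
qed

lemma norm_scaleC: "norm (c *\<^sub>C x) = cmod c * norm x"
proof -
  have "complex_of_real ((norm (c *\<^sub>C x))\<^sup>2) = c * cnj c * cinner x x"
    by (simp only: cinner_self[symmetric] cinner_scaleC_left cinner_scaleC_right mult_ac)
  also have "\<dots> = complex_of_real ((cmod c * norm x)\<^sup>2)"
    by (simp only: complex_norm_square[symmetric] cinner_self of_real_mult[symmetric]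
        power_mult_distrib)
  finally have "(norm (c *\<^sub>C x))\<^sup>2 = (cmod c * norm x)\<^sup>2"
    by (simp only: of_real_eq_iff)
  then show ?thesis by (simp add: power2_eq_iff_nonneg)
qed

lemma cinner_bound: "cmod (cinner x y) \<le> norm x * norm y"
proof -
  \<comment> \<open>Multiplying by this phase rotates the inner product onto the nonnegative axis,
    so the real Cauchy-Schwarz inequality suffices. If the inner product vanishes, \<open>c\<close>
    is 0, hence only the bound 1 on its modulus is used.\<close>
  define c where "c = cnj (sgn (cinner x y))"
  have "c * cinner x y = complex_of_real (cmod (cinner x y))"
  proof (cases "cinner x y = 0")
    case False
    have "c * cinner x y = (cinner x y * cnj (cinner x y)) / complex_of_real (cmod (cinner x y))"
      by (simp add: c_def sgn_eq)
    also have "\<dots> = complex_of_real ((cmod (cinner x y))\<^sup>2 / cmod (cinner x y))"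
      by (simp only: complex_norm_square[symmetric] of_real_divide)
    finally show ?thesis by (simp add: power2_eq_square)
  qed simp
  then have "cmod (cinner x y) = Re (cinner (c *\<^sub>C x) y)"
    by (simp add: cinner_scaleC_left)
  also have "\<dots> \<le> norm (c *\<^sub>C x) * norm y"
    by (simp add: Re_cinner norm_cauchy_schwarz)
  also have "\<dots> \<le> norm x * norm y"
    by (intro mult_right_mono) (auto simp: norm_scaleC c_def norm_sgn)
  finally show ?thesis .
qed

lemma bounded_linear_cinner: "bounded_linear (\<lambda>x. cinner x y)"
proof (rule bounded_linear_intro[where K = "norm y"])
  show "cinner (r *\<^sub>R x) y = r *\<^sub>R cinner x y" for r x
    by (simp add: scaleC_of_real[symmetric] cinner_scaleC_left scaleR_conv_of_real)
qed (simp_all add: cinner_add_left cinner_bound)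

lemma cinner_sum_left: "cinner (\<Sum>i\<in>I. f i) y = (\<Sum>i\<in>I. cinner (f i) y)"
  by (rule linear_sum[OF bounded_linear.linear[OF bounded_linear_cinner]])

section \<open>Orthonormal bases, Bessel and Riesz-Fischer\<close>

locale hilbert_basis =
  fixes e :: "nat \<Rightarrow> 'h::chilbert_space"
  assumes basis: "orthonormal_basis e"
begin

lemma cinner_basis: "cinner (e m) (e n) = (if m = n then 1 else 0)"
  using basis by (simp add: orthonormal_basis_def)

text \<open>Totality of the basis in the form of an induction principle for closed
  conditions.\<close>

lemma closed_subspace_UNIV:
  assumes "closed S" "\<And>n. e n \<in> S" "\<And>c x y. x \<in> S \<Longrightarrow> y \<in> S \<Longrightarrow> c *\<^sub>C x + y \<in> S"
    and "0 \<in> S"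
  shows "x \<in> S"
proof -
  interpret module "scaleC :: complex \<Rightarrow> 'h \<Rightarrow> 'h" by (rule module_scaleC)
  have "y \<in> S" if "y \<in> span (range e)" for y
    using that by (induction rule: span_induct_alt) (use assms in auto)
  then have "span (range e) \<subseteq> S" by blast
  then have "closure (span (range e)) \<subseteq> S"
    using assms(1) by (rule closure_minimal)
  with basis show ?thesis by (auto simp: orthonormal_basis_def)
qed

text \<open>The orthogonal complement of \<open>x\<close> is a closed subspace containing the basis,
  hence contains \<open>x\<close> itself.\<close>

lemma eq_zeroI:
  assumes "\<And>n. cinner x (e n) = 0"
  shows "x = 0"
proof -
  have "x \<in> {y. cinner y x = 0}"
  proof (rule closed_subspace_UNIV)
    show "closed {y. cinner y x = 0}"
      using linear_continuous_on[OF bounded_linear_cinner] by (intro closed_Collect_eq) auto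
    show "e n \<in> {y. cinner y x = 0}" for n
      using assms[of n] by (subst (asm) cinner_commute) simp
  qed (auto simp: cinner_add_left cinner_scaleC_left linear_0[OF bounded_linear.linear[OF bounded_linear_cinner]])
  then show ?thesis by (simp add: cinner_self)
qed

lemma vector_eqI: "(\<And>n. cinner x (e n) = cinner y (e n)) \<Longrightarrow> x = y"
  using eq_zeroI[of "x - y"] by (simp add: cinner_diff_left)

lemma operator_eqI:
  assumes T: "bounded_linear T" "\<And>c x. T (c *\<^sub>C x) = c *\<^sub>C T x"
    and S: "bounded_linear S" "\<And>c x. S (c *\<^sub>C x) = c *\<^sub>C S x"
    and eq: "\<And>n. T (e n) = S (e n)"
  shows "T = S"
proof
  fix x
  have "x \<in> {x. T x = S x}"
  proof (rule closed_subspace_UNIV)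
    show "closed {x. T x = S x}"
      using linear_continuous_on[OF T(1)] linear_continuous_on[OF S(1)]
      by (intro closed_Collect_eq) auto
  qed (auto simp: eq T S linear_add[OF bounded_linear.linear] linear_0[OF bounded_linear.linear])
  then show "T x = S x" by simp
qed

lemma cinner_basis_sum:
  "finite F \<Longrightarrow> cinner (\<Sum>i\<in>F. a i *\<^sub>C e i) (e n) = (if n \<in> F then a n else 0)"
  by (simp add: cinner_sum_left cinner_scaleC_left cinner_basis if_distrib cong: if_cong)

lemma norm_basis_sum:
  assumes "finite F"
  shows "norm (\<Sum>i\<in>F. a i *\<^sub>C e i) = L2_set (\<lambda>i. cmod (a i)) F"
proof -
  let ?v = "\<Sum>i\<in>F. a i *\<^sub>C e i"
  have "cinner ?v ?v = (\<Sum>i\<in>F. a i * cnj (cinner ?v (e i)))"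
    by (subst cinner_sum_left) (simp add: cinner_scaleC_left cinner_commute[of "e _" ?v])
  also have "\<dots> = (\<Sum>i\<in>F. complex_of_real ((cmod (a i))\<^sup>2))"
    using assms by (intro sum.cong refl) (simp add: cinner_basis_sum complex_norm_square[symmetric] del: of_real_power)
  finally have "(norm ?v)\<^sup>2 = (\<Sum>i\<in>F. (cmod (a i))\<^sup>2)"
    by (simp only: cinner_self of_real_sum[symmetric] of_real_eq_iff)
  then show ?thesis
    by (simp add: L2_set_def real_sqrt_unique)
qed

text \<open>Pairing the finite partial expansion \<open>?v\<close> with \<open>x\<close> gives
  \<open>?L\<^sup>2\<close>, while Cauchy-Schwarz bounds it by \<open>?L * norm x\<close>.\<close>

lemma bessel: "l2_le (\<lambda>n. cinner x (e n)) (norm x)"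
proof (rule l2_leI)
  fix F :: "nat set" assume F: "finite F"
  let ?a = "\<lambda>n. cinner x (e n)"
  let ?v = "\<Sum>n\<in>F. ?a n *\<^sub>C e n"
  let ?L = "L2_set (\<lambda>n. cmod (?a n)) F"
  have "cinner ?v x = (\<Sum>n\<in>F. complex_of_real ((cmod (?a n))\<^sup>2))"
    by (simp add: cinner_sum_left cinner_scaleC_left cinner_commute[of "e _" x]
        complex_norm_square[symmetric] del: of_real_power)
  also have "\<dots> = complex_of_real (?L\<^sup>2)"
    by (simp add: L2_set_def sum_nonneg)
  finally have "?L\<^sup>2 = cmod (cinner ?v x)"
    by (simp add: norm_power)
  also have "\<dots> \<le> ?L * norm x"
    using cinner_bound[of ?v x] by (simp add: norm_basis_sum[OF F])
  finally have "?L * ?L \<le> ?L * norm x" by (simp add: power2_eq_square)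
  then show "?L \<le> norm x"
    by (cases "?L = 0") (auto dest: mult_left_le_imp_le simp: order_less_le)
qed

lemma riesz_fischer:
  assumes a: "l2_le a M"
  obtains v where "\<And>n. cinner v (e n) = a n" "norm v \<le> M"
proof -
  let ?f = "\<lambda>n. a n *\<^sub>C e n"
  have "summable ?f"
  proof (rule summable_Cauchy[THEN iffD2], intro allI impI)
    fix \<epsilon> :: real assume "\<epsilon> > 0"
    then obtain F where F: "finite F"
      "\<And>G. finite G \<Longrightarrow> F \<subseteq> G \<Longrightarrow> l2_le (\<lambda>k. if k \<in> G then 0 else a k) (\<epsilon> / 2)"
      using l2_le_tail[OF a, of "\<epsilon> / 2"] by auto
    obtain N where N: "F \<subseteq> {..<N}"
      using F(1) finite_nat_bounded by blast
    have "norm (sum ?f {m..<n}) < \<epsilon>" if "m \<ge> N" for m n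
    proof -
      \<comment> \<open>Indices from \<open>m\<close> on avoid the removed segment, so this block is
        also a block of the tail.\<close>
      have "norm (sum ?f {m..<n}) = L2_set (\<lambda>k. cmod (if k \<in> {..<N} then 0 else a k)) {m..<n}"
        unfolding norm_basis_sum[OF finite_atLeastLessThan] using that by (intro L2_set_cong) auto
      also have "\<dots> \<le> \<epsilon> / 2"
        using F(2)[OF _ N] by (intro l2_leD) simp
      finally show ?thesis using \<open>\<epsilon> > 0\<close> by simp
    qed
    then show "\<exists>N. \<forall>m\<ge>N. \<forall>n. norm (sum ?f {m..<n}) < \<epsilon>" by blast
  qed
  then have lim: "(\<lambda>n. sum ?f {..<n}) \<longlonglongrightarrow> suminf ?f"
    by (rule summable_LIMSEQ)
  show ?thesis
  proof (rule that)
    fix k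
    have "(\<lambda>n. cinner (sum ?f {..<n}) (e k)) \<longlonglongrightarrow> cinner (suminf ?f) (e k)"
      by (rule bounded_linear.tendsto[OF bounded_linear_cinner lim])
    moreover have "(\<lambda>n. cinner (sum ?f {..<n}) (e k)) \<longlonglongrightarrow> a k"
    proof (rule tendsto_eventually)
      show "\<forall>\<^sub>F n in sequentially. cinner (sum ?f {..<n}) (e k) = a k"
        using eventually_gt_at_top[of k] by eventually_elim (simp add: cinner_basis_sum)
    qed
    ultimately show "cinner (suminf ?f) (e k) = a k"
      by (rule LIMSEQ_unique)
  next
    show "norm (suminf ?f) \<le> M"
      by (rule LIMSEQ_le_const2[OF tendsto_norm[OF lim]])
        (auto simp: norm_basis_sum intro!: exI l2_leD[OF a])
  qed
qed

text \<open>The nontrivial half of Parseval: Riesz-Fischer supplies a vector of norm at most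
  \<open>M\<close> with the same coefficients, and it must be \<open>v\<close>.\<close>

lemma norm_le_l2: "l2_le (\<lambda>n. cinner v (e n)) M \<Longrightarrow> norm v \<le> M"
  by (metis riesz_fischer vector_eqI)

section \<open>Hilbert-Schmidt operators as square-summable matrices\<close>

abbreviation HS where "HS \<equiv> hilbert_schmidt e"

definition hs_coord :: "nat \<times> nat \<Rightarrow> ('h \<Rightarrow> 'h) \<Rightarrow> complex" where
  "hs_coord k T = matrix_entry e T (fst k) (snd k)"

lemma hs_bounded_linear: "T \<in> HS \<Longrightarrow> bounded_linear T"
  and hs_scaleC: "T \<in> HS \<Longrightarrow> T (z *\<^sub>C x) = z *\<^sub>C T x"
  by (auto simp: hilbert_schmidt_def)

text \<open>Bessel in every column. Its purpose is summability, without which the infinite sum in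
  \<open>hs_norm\<close> would be 0 by default; \<open>hs_coord_l2\<close> then restates the bound
  with that norm.\<close>

lemma hs_coord_bounded:
  assumes "T \<in> HS"
  shows "l2_le (\<lambda>k. hs_coord k T) (sqrt (\<Sum>s. (norm (T (e s)))\<^sup>2))"
proof (rule l2_leI)
  fix F :: "(nat \<times> nat) set" assume F: "finite F"
  have sm: "summable (\<lambda>s. (norm (T (e s)))\<^sup>2)"
    using assms by (simp add: hilbert_schmidt_def)
  have "(\<Sum>k\<in>F. (cmod (hs_coord k T))\<^sup>2) \<le> (\<Sum>k\<in>fst ` F \<times> snd ` F. (cmod (hs_coord k T))\<^sup>2)"
    using F by (intro sum_mono2 subset_fst_snd) auto
  also have "\<dots> = (\<Sum>s\<in>snd ` F. \<Sum>r\<in>fst ` F. (cmod (cinner (T (e s)) (e r)))\<^sup>2)"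
    by (subst sum.swap) (simp add: sum.cartesian_product hs_coord_def matrix_entry_def case_prod_unfold)
  also have "\<dots> \<le> (\<Sum>s\<in>snd ` F. (norm (T (e s)))\<^sup>2)"
    by (intro sum_mono l2_le_sum_squares bessel)
  also have "\<dots> \<le> (\<Sum>s. (norm (T (e s)))\<^sup>2)"
    using F sm by (intro sum_le_suminf) auto
  finally show "L2_set (\<lambda>k. cmod (hs_coord k T)) F \<le> sqrt (\<Sum>s. (norm (T (e s)))\<^sup>2)"
    by (simp add: L2_set_def)
qed

lemma hs_coord_l2:
  assumes "T \<in> HS"
  shows "l2_le (\<lambda>k. hs_coord k T) (hs_norm e T)"
proof (rule l2_leI)
  fix F :: "(nat \<times> nat) set" assume F: "finite F"
  have "(\<Sum>k\<in>F. (cmod (hs_coord k T))\<^sup>2) \<le> (\<Sum>\<^sub>\<infinity>k. (cmod (hs_coord k T))\<^sup>2)"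
    using F by (intro finite_sum_le_infsum l2_le_squares_summable[OF hs_coord_bounded[OF assms]]) auto
  then show "L2_set (\<lambda>k. cmod (hs_coord k T)) F \<le> hs_norm e T"
    by (simp add: L2_set_def hs_norm_def hs_coord_def case_prod_unfold)
qed

lemma hs_norm_le:
  assumes "l2_le (\<lambda>k. hs_coord k T) M"
  shows "hs_norm e T \<le> M"
proof -
  have "(\<Sum>\<^sub>\<infinity>k. (cmod (hs_coord k T))\<^sup>2) \<le> M\<^sup>2"
    by (rule infsum_le_finite_sums[OF l2_le_squares_summable[OF assms] l2_le_sum_squares[OF assms]])
  then show ?thesis
    using l2_le_nonneg[OF assms]
    by (simp add: hs_norm_def hs_coord_def case_prod_unfold real_le_lsqrt infsum_nonneg)
qed

text \<open>The operator multiplies coordinate vectors by the matrix: Riesz-Fischer turns the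
  resulting coefficients into a vector, and Cauchy-Schwarz in each row bounds its norm.\<close>

lemma operator_of_matrix:
  assumes m: "l2_le m M"
  obtains T where "T \<in> HS" "\<And>k. hs_coord k T = m k"
proof -
  let ?x = "\<lambda>x s. cinner x (e s)"
  let ?a = "\<lambda>x r. \<Sum>\<^sub>\<infinity>s. m (r, s) * ?x x s"
  have row: "l2_le (\<lambda>s. m (r, s)) M" for r
    by (rule l2_le_inj[OF m]) (simp add: inj_on_def)
  have col: "l2_le (\<lambda>r. m (r, s)) M" for s
    by (rule l2_le_inj[OF m]) (simp add: inj_on_def)
  have sum: "(\<lambda>s. m (r, s) * ?x x s) summable_on UNIV" for r x
    by (rule l2_le_mult_summable[OF row bessel])
  \<comment> \<open>For finitely many columns the bound is finite Cauchy-Schwarz; lower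
    semicontinuity passes it to the full row sums.\<close>
  have a: "l2_le (?a x) (M * norm x)" for x
  proof (rule l2_le_limit[of "finite_subsets_at_top UNIV"])
    show "((\<lambda>G. \<Sum>s\<in>G. m (r, s) * ?x x s) \<longlongrightarrow> ?a x r) (finite_subsets_at_top UNIV)" for r
      using has_sum_infsum[OF sum] by (simp add: has_sum_def)
    show "l2_le (\<lambda>r. \<Sum>s\<in>G. m (r, s) * ?x x s) (M * norm x)" for G
    proof (rule l2_leI)
      fix F :: "nat set" assume F: "finite F"
      have "L2_set (\<lambda>r. cmod (\<Sum>s\<in>G. m (r, s) * ?x x s)) F \<le>
          L2_set (\<lambda>r. L2_set (\<lambda>s. cmod (m (r, s))) G * norm x) F"
      proof (intro L2_set_mono)
        fix r
        have "cmod (\<Sum>s\<in>G. m (r, s) * ?x x s) \<le> (\<Sum>s\<in>G. cmod (m (r, s)) * cmod (?x x s))"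
          by (rule order_trans[OF norm_sum]) (simp add: norm_mult)
        also have "\<dots> \<le> L2_set (\<lambda>s. cmod (m (r, s))) G * L2_set (\<lambda>s. cmod (?x x s)) G"
          using L2_set_mult_ineq[of "\<lambda>s. cmod (m (r, s))" "\<lambda>s. cmod (?x x s)" G] by simp
        also have "\<dots> \<le> L2_set (\<lambda>s. cmod (m (r, s))) G * norm x"
          by (intro mult_left_mono l2_leD[OF bessel] L2_set_nonneg)
        finally show "cmod (\<Sum>s\<in>G. m (r, s) * ?x x s) \<le> L2_set (\<lambda>s. cmod (m (r, s))) G * norm x" .
      qed simp
      also have "\<dots> = L2_set (\<lambda>k. cmod (m k)) (F \<times> G) * norm x"
        by (subst L2_set_left_distrib[symmetric])
          (simp_all add: L2_set_def sum_nonneg sum.cartesian_product case_prod_unfold)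
      also have "\<dots> \<le> M * norm x"
        by (intro mult_right_mono l2_leD[OF m] norm_ge_zero)
      finally show "L2_set (\<lambda>r. cmod (\<Sum>s\<in>G. m (r, s) * ?x x s)) F \<le> M * norm x" .
    qed
  qed simp_all
  have "\<exists>v. (\<forall>r. cinner v (e r) = ?a x r) \<and> norm v \<le> M * norm x" for x
    using riesz_fischer[OF a[of x]] by metis
  then obtain T where T: "\<And>x r. cinner (T x) (e r) = ?a x r" "\<And>x. norm (T x) \<le> M * norm x"
    by metis
  have T_add: "T (x + y) = T x + T y" for x y
    by (rule vector_eqI) (simp add: T cinner_add_left distrib_left infsum_add sum)
  have T_scale: "T (z *\<^sub>C x) = z *\<^sub>C T x" for z x
    by (rule vector_eqI)
      (simp add: T cinner_scaleC_left mult.left_commute[of _ z] infsum_cmult_right')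
  have bl: "bounded_linear T"
    by (rule bounded_linear_intro[where K = M])
      (simp_all add: T_add T_scale scaleC_of_real[symmetric] T(2) mult.commute)
  have coord: "hs_coord k T = m k" for k
  proof -
    have "?a (e (snd k)) (fst k) = m (fst k, snd k)"
      by (rule infsumI, rule has_sum_finite_neutralI[of "{snd k}"]) (auto simp: cinner_basis)
    then show ?thesis by (simp add: hs_coord_def matrix_entry_def T)
  qed
  have "summable (\<lambda>s. (norm (T (e s)))\<^sup>2)"
  proof (rule summable_comparison_test')
    \<comment> \<open>Transposition puts the column index outside, so that the joint sum of squares
      splits into column sums, which dominate the squared norms of the images of the basis
      vectors.\<close>
    have "l2_le (\<lambda>k. m (snd k, fst k)) M"
      by (rule l2_le_inj[OF m]) (auto simp: inj_on_def prod_eq_iff)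
    then have "(\<lambda>s. \<Sum>\<^sub>\<infinity>r. (cmod (m (r, s)))\<^sup>2) summable_on UNIV"
      using summable_on_Sigma_banach[of "\<lambda>s r. (cmod (m (r, s)))\<^sup>2" UNIV "\<lambda>_. UNIV"]
      by (auto simp: case_prod_unfold dest: l2_le_squares_summable)
    then show "summable (\<lambda>s. \<Sum>\<^sub>\<infinity>r. (cmod (m (r, s)))\<^sup>2)"
      by (rule summable_on_imp_summable)
    fix s
    have entries: "cinner (T (e s)) (e r) = m (r, s)" for r
      using coord[of "(r, s)"] by (simp add: hs_coord_def matrix_entry_def)
    have "norm (T (e s)) \<le> sqrt (\<Sum>\<^sub>\<infinity>r. (cmod (m (r, s)))\<^sup>2)"
    proof (rule norm_le_l2, rule l2_leI)
      fix F :: "nat set" assume "finite F"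
      then have "(\<Sum>r\<in>F. (cmod (m (r, s)))\<^sup>2) \<le> (\<Sum>\<^sub>\<infinity>r. (cmod (m (r, s)))\<^sup>2)"
        by (intro finite_sum_le_infsum l2_le_squares_summable[OF col]) auto
      then show "L2_set (\<lambda>r. cmod (cinner (T (e s)) (e r))) F \<le> sqrt (\<Sum>\<^sub>\<infinity>r. (cmod (m (r, s)))\<^sup>2)"
        by (simp add: L2_set_def entries)
    qed
    then show "norm ((norm (T (e s)))\<^sup>2) \<le> (\<Sum>\<^sub>\<infinity>r. (cmod (m (r, s)))\<^sup>2)"
      by (simp add: real_le_rsqrt sqrt_ge_absD)
  qed
  then have "T \<in> HS"
    using bl T_scale by (simp add: hilbert_schmidt_def)
  with coord that show ?thesis by blast
qed

lemma coord_operator_eqI: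
  assumes "bounded_linear T" "\<And>z x. T (z *\<^sub>C x) = z *\<^sub>C T x"
    and "bounded_linear S" "\<And>z x. S (z *\<^sub>C x) = z *\<^sub>C S x"
    and eq: "\<And>k. hs_coord k T = hs_coord k S"
  shows "T = S"
  using assms(1-4)
proof (rule operator_eqI)
  fix s
  show "T (e s) = S (e s)"
    using eq[of "(_, s)"] by (intro vector_eqI) (simp add: hs_coord_def matrix_entry_def)
qed

lemma hs_eqI: "T \<in> HS \<Longrightarrow> S \<in> HS \<Longrightarrow> (\<And>k. hs_coord k T = hs_coord k S) \<Longrightarrow> T = S"
  by (rule coord_operator_eqI) (auto simp: hs_bounded_linear hs_scaleC)

text \<open>An operator with a square-summable matrix agrees on the basis with the Hilbert-Schmidt
  operator built from that matrix, hence everywhere.\<close>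

lemma hsI:
  assumes "bounded_linear T" "\<And>z x. T (z *\<^sub>C x) = z *\<^sub>C T x" "l2_le (\<lambda>k. hs_coord k T) M"
  shows "T \<in> HS"
proof -
  obtain S where S: "S \<in> HS" "\<And>k. hs_coord k S = hs_coord k T"
    using operator_of_matrix[OF assms(3)] by metis
  have "T = S"
    using assms S by (intro coord_operator_eqI) (auto simp: hs_bounded_linear hs_scaleC)
  with S show ?thesis by simp
qed

lemma hs_coord_add: "hs_coord k (\<lambda>x. T x + S x) = hs_coord k T + hs_coord k S"
  by (simp add: hs_coord_def matrix_entry_def cinner_add_left)

lemma hs_coord_scale: "hs_coord k (\<lambda>x. z *\<^sub>C T x) = z * hs_coord k T"
  by (simp add: hs_coord_def matrix_entry_def cinner_scaleC_left)

lemma bounded_linear_scaleC: "bounded_linear (\<lambda>x. z *\<^sub>C x)"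
  by (rule bounded_linear_intro[where K = "cmod z"])
    (simp_all add: scaleC_add_right scaleC_of_real[symmetric] scaleC_scaleC norm_scaleC mult.commute)

lemma hs_add:
  assumes T: "T \<in> HS" and S: "S \<in> HS"
  shows "(\<lambda>x. T x + S x) \<in> HS"
proof (rule hsI)
  show "bounded_linear (\<lambda>x. T x + S x)"
    by (intro bounded_linear_add hs_bounded_linear T S)
  show "l2_le (\<lambda>k. hs_coord k (\<lambda>x. T x + S x)) (hs_norm e T + hs_norm e S)"
    unfolding hs_coord_add by (rule l2_le_add[OF hs_coord_l2[OF T] hs_coord_l2[OF S]])
qed (simp add: hs_scaleC T S scaleC_add_right)

lemma hs_scale:
  assumes T: "T \<in> HS"
  shows "(\<lambda>x. z *\<^sub>C T x) \<in> HS"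
proof (rule hsI)
  show "bounded_linear (\<lambda>x. z *\<^sub>C T x)"
    by (rule bounded_linear_compose[OF bounded_linear_scaleC hs_bounded_linear[OF T]])
  show "l2_le (\<lambda>k. hs_coord k (\<lambda>x. z *\<^sub>C T x)) (cmod z * hs_norm e T)"
    unfolding hs_coord_scale by (rule l2_le_scale[OF hs_coord_l2[OF T]])
qed (simp add: hs_scaleC T scaleC_scaleC mult.commute)

definition hs_of :: "(nat \<times> nat \<Rightarrow> complex) \<Rightarrow> 'h \<Rightarrow> 'h" where
  "hs_of m = (SOME T. T \<in> HS \<and> (\<forall>k. hs_coord k T = m k))"

lemma hs_of:
  assumes "l2_le m M"
  shows "hs_of m \<in> HS" "hs_coord k (hs_of m) = m k"
proof -
  have "\<exists>T. T \<in> HS \<and> (\<forall>k. hs_coord k T = m k)"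
    using operator_of_matrix[OF assms] by metis
  from someI_ex[OF this, folded hs_of_def] show "hs_of m \<in> HS" "hs_coord k (hs_of m) = m k"
    by blast+
qed

lemma hs_of_norm: "l2_le m M \<Longrightarrow> hs_norm e (hs_of m) \<le> M"
  by (rule hs_norm_le) (simp add: hs_of)

text \<open>One factor serves only as a bounded multiplier, its entries being bounded by its
  Hilbert-Schmidt norm.\<close>

lemma hs_coord_mult_l2:
  assumes "T \<in> HS" "S \<in> HS"
  shows "l2_le (\<lambda>k. hs_coord k T * hs_coord k S) (hs_norm e T * hs_norm e S)"
  by (intro l2_le_bounded_mult l2_le_cmod hs_coord_l2 assms)

lemma schur_eq:
  assumes T: "T \<in> HS" and S: "S \<in> HS"
  shows "schur_product e T S = hs_of (\<lambda>k. hs_coord k T * hs_coord k S)"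
  unfolding schur_product_def
proof (rule the_equality)
  note R = hs_of[OF hs_coord_mult_l2[OF T S]]
  show "hs_of (\<lambda>k. hs_coord k T * hs_coord k S) \<in> HS \<and>
    (\<forall>r s. matrix_entry e (hs_of (\<lambda>k. hs_coord k T * hs_coord k S)) r s =
      matrix_entry e T r s * matrix_entry e S r s)"
    using R(1) R(2)[of "(_, _)"] by (simp add: hs_coord_def)
  fix R' assume R': "R' \<in> HS \<and>
    (\<forall>r s. matrix_entry e R' r s = matrix_entry e T r s * matrix_entry e S r s)"
  then have "hs_coord k R' = hs_coord k T * hs_coord k S" for k
    by (simp add: hs_coord_def)
  with R' show "R' = hs_of (\<lambda>k. hs_coord k T * hs_coord k S)"
    by (intro hs_eqI R(1)) (simp_all only: R(2))
qed

lemma schur_hs: "T \<in> HS \<Longrightarrow> S \<in> HS \<Longrightarrow> schur_product e T S \<in> HS"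
  by (simp add: schur_eq hs_of(1)[OF hs_coord_mult_l2])

lemma schur_coord:
  "T \<in> HS \<Longrightarrow> S \<in> HS \<Longrightarrow> hs_coord k (schur_product e T S) = hs_coord k T * hs_coord k S"
  by (simp add: schur_eq hs_of(2)[OF hs_coord_mult_l2])

lemma S2_simps [simp]:
  "vcarrier (S2 e) = HS" "vadd (S2 e) T S = (\<lambda>x. T x + S x)" "vscale (S2 e) z T = (\<lambda>x. z *\<^sub>C T x)"
  "vnorm (S2 e) = hs_norm e" "vmult (S2 e) = schur_product e"
  by (simp_all add: S2_def)

lemma bilinear_mult_S2: "bilinear_mult (S2 e)"
  unfolding bilinear_mult_def S2_simps
  by (intro ballI conjI allI hs_add schur_hs hs_scale; (assumption | rule hs_eqI)?;
      simp add: hs_add hs_scale schur_hs schur_coord hs_coord_add hs_coord_scale algebra_simps)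

text \<open>Through \<open>hs_of\<close> the form becomes a bounded functional on l2 of the matrix
  positions, expanded at the entries of the Schur product.\<close>

lemma S2_mult_expansion:
  assumes lin: "linear_form (S2 e) \<omega>"
    and bdd: "\<And>T. T \<in> HS \<Longrightarrow> cmod (\<omega> T) \<le> K * hs_norm e T"
    and T: "T \<in> HS" and S: "S \<in> HS"
  shows "((\<lambda>k. \<omega> (hs_of (unit_seq k)) * (hs_coord k T * hs_coord k S))
    has_sum \<omega> (schur_product e T S)) UNIV"
proof -
  interpret l2_functional "\<lambda>x. \<omega> (hs_of x)" "\<bar>K\<bar>"
  proof
    fix x y :: "nat \<times> nat \<Rightarrow> complex" and M N z
    assume x: "l2_le x M"
    \<comment> \<open>\<open>hs_of\<close> is a choice, so its linearity rests on the uniqueness of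
      the operator with a given matrix.\<close>
    have "hs_of (\<lambda>k. z * x k) = (\<lambda>v. z *\<^sub>C hs_of x v)"
      using hs_of[OF x] hs_of[OF l2_le_scale[OF x]]
      by (intro hs_eqI) (simp_all add: hs_scale hs_coord_scale)
    then show "\<omega> (hs_of (\<lambda>k. z * x k)) = z * \<omega> (hs_of x)"
      using lin hs_of(1)[OF x] by (simp add: linear_form_def)
    have "cmod (\<omega> (hs_of x)) \<le> K * hs_norm e (hs_of x)"
      by (rule bdd[OF hs_of(1)[OF x]])
    also have "\<dots> \<le> \<bar>K\<bar> * M"
      by (intro mult_mono hs_of_norm[OF x] l2_le_nonneg[OF hs_coord_l2[OF hs_of(1)[OF x]]]) auto
    finally show "cmod (\<omega> (hs_of x)) \<le> \<bar>K\<bar> * M" .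
    assume y: "l2_le y N"
    have "hs_of (\<lambda>k. x k + y k) = (\<lambda>v. hs_of x v + hs_of y v)"
      using hs_of[OF x] hs_of[OF y] hs_of[OF l2_le_add[OF x y]]
      by (intro hs_eqI) (simp_all add: hs_add hs_coord_add)
    then show "\<omega> (hs_of (\<lambda>k. x k + y k)) = \<omega> (hs_of x) + \<omega> (hs_of y)"
      using lin hs_of(1)[OF x] hs_of(1)[OF y] by (simp add: linear_form_def)
  qed
  show ?thesis
    using expansion[OF hs_coord_mult_l2[OF T S]] by (simp add: schur_eq T S mult_ac)
qed

theorem S2_coordinate_algebra: "coordinate_algebra (S2 e) hs_coord (\<lambda>k. hs_of (unit_seq k))"
proof (unfold_locales, goal_cases)
  case (3 k)
  show ?case by (simp add: linear_form_def hs_coord_add hs_coord_scale)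
next
  case (7 \<omega> K T S)
  then show ?case using S2_mult_expansion[of \<omega> K T S] by simp
next
  case (9 T z)
  then have T: "T \<in> HS" by simp
  have "l2_le (\<lambda>k. hs_coord k (\<lambda>x. z *\<^sub>C T x)) (cmod z * hs_norm e T)"
    unfolding hs_coord_scale by (rule l2_le_scale[OF hs_coord_l2[OF T]])
  then show ?case by (simp add: hs_norm_le)
next
  case (10 T S)
  then have "T \<in> HS" "S \<in> HS" by simp_all
  with hs_coord_mult_l2[OF this] show ?case by (simp add: hs_norm_le schur_coord)
qed (simp_all add: hs_add hs_scale hs_coord_l2 hs_of(1)[OF l2_le_unit_seq]
    hs_of_norm[OF l2_le_unit_seq] bilinear_mult_S2)

end

theorem theorem5p2:
  fixes e :: "nat \<Rightarrow> 'h::chilbert_space"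
  assumes "orthonormal_basis e"
  shows "arens_regular (projective_tensor (S2 e) (S2 e))"
proof -
  interpret hilbert_basis e
    using assms by unfold_locales
  let ?E = "\<lambda>k. hs_of (unit_seq k)"
  interpret S: coordinate_algebra "S2 e" hs_coord ?E
    by (rule S2_coordinate_algebra)
  interpret T: tensor_of_coordinate_algebras "S2 e" hs_coord ?E "S2 e" hs_coord ?E ..
  interpret F: coordinate_function_algebra "algebraic_tensor (S2 e) (S2 e)" T.tensor_coord T.tensor_unit
    by (rule T.tensor_coordinate_function_algebra)
  \<comment> \<open>The coordinates are indexed by pairs of matrix positions, one for each tensor
    factor.\<close>
  interpret C: coordinates "completion (algebraic_tensor (S2 e) (S2 e))" F.completion_coord
      "\<lambda>k. F.embed (T.tensor_unit k)"
    by (rule F.completion_coordinates)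
  show ?thesis
    unfolding projective_tensor_def by (rule C.arens_regular)
qed

end
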